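(* Let $q$ be a prime power and let $1\le n\le\ell$ be integers. Let $\mathcal L$ be a non-empty subset of $\mathcal M_n$ with $|\mathcal L|=xq^{(n-1)\ell}$, where $x$ is an integer. Then the following properties are equivalent. (i) $\chi_{\mathcal L}\in{\rm Im}(M^t)$. (ii) $\chi_{\mathcal L}\in\ker(M)^{\perp}$. (iii) For every $\pi\in\mathcal M_n$, the number of elements of $\mathcal L$ disjoint to $\pi$ is $(x-(\chi_{\mathcal L})_\pi)\,q^{\binom n2}\prod_{s=1}^{n-1}(q^{\ell-n+s}-1)$. (iv) The vector $v=\chi_{\mathcal L}-xq^{-\ell}\,{\rm j}$ is a vector in $V_1$. (v) $\chi_{\mathcal L}\in V_0\oplus V_1$. (vi) $|\mathcal L\cap\mathcal S|=x$ for every attenuated $n$-spread $\mathcal S$ in $A_q(n+\ell,E)$. (vii) For every pair of conjugate switching sets $\mathcal R$ and $\mathcal R'$, $|\mathcal L\cap\mathcal R|=|\mathcal L\cap\mathcal R'|$.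
   Context: Let $E=\langle e_{n+1},\dots,e_{n+\ell}\rangle\subseteq\mathbb F_q^{n+\ell}$, where $e_i$ are the standard basis vectors. The attenuated space $A_q(n+\ell,E)$ is the collection of all subspaces of $\mathbb F_q^{n+\ell}$ meeting $E$ trivially; $\mathcal M_m$ is the set of its $m$-dimensional members. Two subspaces are disjoint if they intersect in $\{0\}$. $M$ is the real $0/1$ incidence matrix with rows indexed by $\mathcal M_1$ and columns by $\mathcal M_n$ (entry $1$ iff contained). For $\mathcal S\subseteq\mathcal M_n$, $\chi_{\mathcal S}\in\mathbb R^{\mathcal M_n}$ is the characteristic vector, and $(\chi_{\mathcal S})_\pi$ is its entry at $\pi$; ${\rm j}$ is the all-one vector. Let $K$ be the adjacency matrix of the graph on $\mathcal M_n$ in which two vertices are adjacent iff they are disjoint. Its distinct eigenvalues are $\lambda_j=(-1)^jq^{\binom n2}\prod_{s=1}^{n-j}(q^{\ell-n+s}-1)$, $j=0,\dots,n$; $V_j\subseteq\mathbb R^{\mathcal M_n}$ denotes the eigenspace of $K$ for $\lambda_j$ (in particular $V_0=\langle{\rm j}\rangle$). An attenuated $n$-spread in $A_q(n+\ell,E)$ is a set of $q^\ell$ subspaces in $\mathcal M_n$ which together with $E$ partition $\mathbb F_q^{n+\ell}$, i.e. every one-dimensional subspace of $\mathbb F_q^{n+\ell}$ lies in exactly one of these subspaces or $E$ (equivalently every element of $\mathcal M_1$ lies in exactly one member of the set). An attenuated partial $n$-spread is any subset of an attenuated $n$-spread. A pair of conjugate switching sets is a pair of disjoint (as sets) attenuated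 partial $n$-spreads that cover the same subset of $\mathcal M_1$ (an element of $\mathcal M_1$ is covered if it is contained in some member). *)

theory Defs
  imports "HOL-Analysis.Analysis"
begin

text \<open>
  The field with \<open>q\<close> elements is a type \<open>'a\<close> of class \<open>field\<close> and \<open>finite\<close>, with \<open>q = CARD('a)\<close>;
  the space of dimension \<open>n + \<ell>\<close> over it is \<open>'a ^ ('n + 'l)\<close> with \<open>n = CARD('n)\<close> and
  \<open>\<ell> = CARD('l)\<close>.  The first \<open>n\<close> coordinates are those of the form \<open>Inl i\<close>, the last \<open>\<ell>\<close> those
  of the form \<open>Inr j\<close>.  Linear algebra over \<open>'a\<close> is that of the \<open>vec\<close> interpretation.
\<close>

definition att_E :: "('a::{field,finite} ^ ('n::finite + 'l::finite)) set" where
  "att_E = vec.span (range (\<lambda>j::'l. axis (Inr j) 1))"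

definition att_subspaces :: "nat \<Rightarrow> ('a::{field,finite} ^ ('n::finite + 'l::finite)) set set" where
  "att_subspaces m = {U. vec.subspace U \<and> vec.dim U = m \<and> U \<inter> att_E = {0}}"

lemma att_E_Inl:
  fixes v :: "'a::{field,finite} ^ ('n::finite + 'l::finite)"
  assumes "v \<in> att_E"
  shows "v $ Inl i = 0"
proof -
  have "vec.subspace {v :: 'a ^ ('n + 'l). v $ Inl i = 0}"
    by (simp add: vec.subspace_def)
  then have "(att_E :: ('a ^ ('n + 'l)) set) \<subseteq> {v. v $ Inl i = 0}"
    unfolding att_E_def by (intro vec.span_minimal) (auto simp: axis_def)
  then show ?thesis using assms by auto
qed

lemma att_subspaces_nonempty:
  fixes I :: "'n::finite set"
  shows "{v :: 'a::{field,finite} ^ ('n + 'l::finite). \<forall>k. k \<notin> Inl ` I \<longrightarrow> v $ k = 0}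
           \<in> att_subspaces (card I)" (is "?U \<in> _")
proof -
  have "vec.subspace ?U" by (simp add: vec.subspace_def)
  moreover have "vec.dim ?U = card I"
    by (simp only: dim_substandard_cart) (simp add: card_image)
  moreover have "?U \<inter> att_E = {0}"
  proof (intro equalityI subsetI)
    fix v assume v: "v \<in> ?U \<inter> att_E"
    have "v $ k = 0" for k
      by (cases k) (use v att_E_Inl in auto)
    then show "v \<in> {0}" by (simp add: vec_eq_iff)
  qed (simp add: att_E_def vec.span_zero)
  ultimately show ?thesis by (simp add: att_subspaces_def)
qed

text \<open>
  The one-dimensional and the \<open>n\<close>-dimensional members are made into types, so that they can index
  the vectors and matrices of the library.
\<close>

typedef (overloaded) ('a, 'n, 'l) att_1 =
    "att_subspaces 1 :: ('a::{field,finite} ^ ('n::finite + 'l::finite)) set set"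
  using att_subspaces_nonempty[of "{undefined :: 'n}"] by auto

typedef (overloaded) ('a, 'n, 'l) att_n =
    "att_subspaces CARD('n) :: ('a::{field,finite} ^ ('n::finite + 'l::finite)) set set"
  using att_subspaces_nonempty[of "UNIV :: 'n set"] by auto

instance att_1 :: ("{field,finite}", finite, finite) finite
proof
  have "inj (Rep_att_1 :: ('a, 'b, 'c) att_1 \<Rightarrow> _)"
    by (auto intro: injI simp: Rep_att_1_inject)
  then show "finite (UNIV :: ('a, 'b, 'c) att_1 set)"
    by (rule finite_imageD[rotated]) simp
qed

instance att_n :: ("{field,finite}", finite, finite) finite
proof
  have "inj (Rep_att_n :: ('a, 'b, 'c) att_n \<Rightarrow> _)"
    by (auto intro: injI simp: Rep_att_n_inject)
  then show "finite (UNIV :: ('a, 'b, 'c) att_n set)"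
    by (rule finite_imageD[rotated]) simp
qed

definition att_disjoint ::
    "('a::{field,finite}, 'n::finite, 'l::finite) att_n \<Rightarrow> ('a, 'n, 'l) att_n \<Rightarrow> bool" where
  "att_disjoint \<pi> \<sigma> \<longleftrightarrow> Rep_att_n \<pi> \<inter> Rep_att_n \<sigma> = {0}"

definition inc_matrix ::
    "real ^ ('a::{field,finite}, 'n::finite, 'l::finite) att_n ^ ('a, 'n, 'l) att_1" where
  "inc_matrix = (\<chi> p \<pi>. if Rep_att_1 p \<subseteq> Rep_att_n \<pi> then 1 else 0)"

definition char_vec :: "'i::finite set \<Rightarrow> real ^ 'i" where
  "char_vec S = (\<chi> i. indicator S i)"

definition disj_matrix ::
    "real ^ ('a::{field,finite}, 'n::finite, 'l::finite) att_n ^ ('a, 'n, 'l) att_n" where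
  "disj_matrix = (\<chi> \<pi> \<sigma>. if att_disjoint \<pi> \<sigma> then 1 else 0)"

text \<open>The exponent \<open>l - n + s\<close> is only meaningful for \<open>n \<le> l\<close>.\<close>

definition disj_eigenvalue :: "nat \<Rightarrow> nat \<Rightarrow> nat \<Rightarrow> nat \<Rightarrow> real" where
  "disj_eigenvalue q n l j =
     (-1) ^ j * real q ^ (n choose 2) * (\<Prod>s=1..n-j. real q ^ (l - n + s) - 1)"

definition disj_eigenspace ::
    "nat \<Rightarrow> (real ^ ('a::{field,finite}, 'n::finite, 'l::finite) att_n) set" where
  "disj_eigenspace j =
     {v. disj_matrix *v v = disj_eigenvalue CARD('a) CARD('n) CARD('l) j *\<^sub>R v}"

definition att_spread :: "('a::{field,finite}, 'n::finite, 'l::finite) att_n set \<Rightarrow> bool" where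
  "att_spread S \<longleftrightarrow>
     card S = CARD('a) ^ CARD('l) \<and>
     (\<forall>P. vec.subspace P \<and> vec.dim P = 1 \<longrightarrow>
       (\<exists>!U. U \<in> insert att_E (Rep_att_n ` S) \<and> P \<subseteq> U))"

definition att_partial_spread ::
    "('a::{field,finite}, 'n::finite, 'l::finite) att_n set \<Rightarrow> bool" where
  "att_partial_spread R \<longleftrightarrow> (\<exists>S. att_spread S \<and> R \<subseteq> S)"

definition covered ::
    "('a::{field,finite}, 'n::finite, 'l::finite) att_n set \<Rightarrow> ('a, 'n, 'l) att_1 set" where
  "covered R = {p. \<exists>\<pi>\<in>R. Rep_att_1 p \<subseteq> Rep_att_n \<pi>}"

definition conjugate_switching ::
    "('a::{field,finite}, 'n::finite, 'l::finite) att_n set \<Rightarrow> ('a, 'n, 'l) att_n set \<Rightarrow> bool" where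
  "conjugate_switching R R' \<longleftrightarrow>
     att_partial_spread R \<and> att_partial_spread R' \<and> R \<inter> R' = {} \<and> covered R = covered R'"

end

theory Submission
  imports Defs "HOL-Algebra.Algebraic_Closure_Type" "HOL-Number_Theory.Cong"
begin

text \<open>
  Members of \<open>\<M>\<^sub>n\<close> are the graphs \<open>{(u, uA)}\<close> of \<open>n \<times> l\<close> matrices \<open>A\<close>, and two graphs are disjoint
  iff \<open>A - B\<close> has linearly independent rows. So \<open>K\<close> is a Cayley matrix of the additive group of
  matrices and is diagonalised by the characters \<open>A \<mapsto> \<psi> (\<Sum>\<^sub>i\<^sub>j B\<^sub>i\<^sub>j A\<^sub>i\<^sub>j)\<close>. Adding one row at a time yields a
  recursion for the eigenvalue at \<open>B\<close>, from which it is \<open>\<lambda>\<^sub>0\<close> for \<open>B = 0\<close>, \<open>\<lambda>\<^sub>1\<close> for rank one, and in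
  \<open>(\<lambda>\<^sub>1, -\<lambda>\<^sub>1]\<close> for rank at least two. A vector of \<open>V\<^sub>0\<close> or \<open>V\<^sub>1\<close> therefore has Fourier support in rank
  at most one, where the Fourier transform of a vector of \<open>ker M\<close> vanishes; Parseval's identity gives
  (v) \<open>\<Longrightarrow>\<close> (ii).

  Conversely (i) implies (vii) since conjugate switching sets have the same image under \<open>M\<close>. Two spreads
  \<open>S\<close>, \<open>S'\<close> give conjugate switching sets \<open>S - S'\<close>, \<open>S' - S\<close>, so (vii) makes \<open>|L \<inter> S|\<close> constant, and the
  constant is found by translating one spread. For (vi) \<open>\<Longrightarrow>\<close> (iii), the multiplication of the field with
  \<open>q\<^sup>l\<close> elements gives for every injective matrix \<open>g\<close> a spread \<open>{A - k g}\<close> through \<open>A\<close>; averaging over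
  \<open>g\<close> counts the members of \<open>L\<close> disjoint from the graph of \<open>A\<close>.
\<close>

hide_const (open) Divisibility.prime up_ring.monom up_ring.coeff
  Polynomials.lead_coeff Polynomials.degree module.smult

no_notation fps_nth (infixl "$" 75)

section \<open>Additive characters\<close>

text \<open>Translating the summation variable by \<open>a\<close> multiplies the sum by
  \<open>h a\<close>, which differs from 1.\<close>

lemma sum_additive_char_eq_0:
  fixes h :: "'b::{finite,ab_group_add} \<Rightarrow> complex"
  assumes hom: "\<And>x y. h (x + y) = h x * h y" and "h a \<noteq> 1"
  shows "(\<Sum>x\<in>UNIV. h x) = 0"
proof -
  have "(\<Sum>x\<in>UNIV. h x) = (\<Sum>x\<in>UNIV. h (a + x))"
    by (rule sum.reindex_bij_witness[of _ "\<lambda>x. a + x" "\<lambda>x. x - a"]) auto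
  also have "\<dots> = h a * (\<Sum>x\<in>UNIV. h x)"
    by (simp add: hom sum_distrib_left)
  finally have "(h a - 1) * (\<Sum>x\<in>UNIV. h x) = 0"
    by (simp add: algebra_simps)
  then show ?thesis using \<open>h a \<noteq> 1\<close> by simp
qed

text \<open>
  A maximal proper additive subgroup \<open>H\<close> has index \<open>p\<close>, the characteristic: if \<open>g \<notin> H\<close> then every element is
  \<open>h + k g\<close> with \<open>h \<in> H\<close> and \<open>k\<close> unique modulo \<open>p\<close>, and \<open>h + k g \<mapsto> exp (2 \<pi> \<i> k / p)\<close> is the character.
\<close>

lemma additive_char_exists:
  obtains \<psi> :: "'a::{field,finite} \<Rightarrow> complex" and g
  where "\<And>x y. \<psi> (x + y) = \<psi> x * \<psi> y" "\<psi> 0 = 1" "\<psi> g \<noteq> 1"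
proof -
  define p where "p = CHAR('a)"
  have "p > 0" unfolding p_def by (rule finite_imp_CHAR_pos) simp
  then have p: "prime p" unfolding p_def by (rule prime_CHAR_semidom)
  have p0: "of_nat p = (0::'a)" by (simp add: p_def)
  define sub where "sub H \<longleftrightarrow> 0 \<in> H \<and> (\<forall>x\<in>H. \<forall>y\<in>H. x + y \<in> H)" for H :: "'a set"
  have sub_add: "x + y \<in> H" if "sub H" "x \<in> H" "y \<in> H" for H x y
    using that by (auto simp: sub_def)
  have sub_mult: "of_nat m * x \<in> H" if "sub H" "x \<in> H" for H x m
    using that by (induction m) (auto simp: sub_def algebra_simps)
  \<comment> \<open>In characteristic \<open>p\<close>, \<open>- x\<close> is the multiple
    \<open>(p - 1) x\<close>, so closure under addition suffices.\<close>
  have sub_uminus: "- x \<in> H" if "sub H" "x \<in> H" for H x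
  proof -
    have "- x = of_nat (p - 1) * x"
      using \<open>p > 0\<close> p0 by (simp add: of_nat_diff)
    then show ?thesis using sub_mult[OF that] by metis
  qed
  have "{0} \<in> {H. sub H \<and> H \<noteq> UNIV}"
  proof -
    have "(1::'a) \<notin> {0}" by simp
    then have "{0::'a} \<noteq> UNIV" by blast
    then show ?thesis by (simp add: sub_def)
  qed
  then have "{H. sub H \<and> H \<noteq> UNIV} \<noteq> {}" by blast
  from finite_has_maximal[OF _ this] obtain H
    where H: "sub H" "H \<noteq> UNIV"
      and max: "\<And>H'. sub H' \<Longrightarrow> H' \<noteq> UNIV \<Longrightarrow> H \<subseteq> H' \<Longrightarrow> H = H'"
    by (metis (mono_tags, lifting) finite mem_Collect_eq)
  from H obtain g where g: "g \<notin> H" by auto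
  \<comment> \<open>The elements congruent modulo \<open>H\<close> to a multiple of \<open>g\<close>
    form a subgroup containing \<open>H\<close> and \<open>g\<close>; by maximality it is
    everything.\<close>
  have ex: "\<exists>k::nat. x - of_nat k * g \<in> H" for x
  proof -
    let ?H = "{x. \<exists>k::nat. x - of_nat k * g \<in> H}"
    have "sub ?H"
      unfolding sub_def
    proof safe
      show "\<exists>k::nat. 0 - of_nat k * g \<in> H"
        by (rule exI[of _ 0]) (use H in \<open>simp add: sub_def\<close>)
      fix x y and k m :: nat assume "x - of_nat k * g \<in> H" "y - of_nat m * g \<in> H"
      from sub_add[OF H(1) this] show "\<exists>k::nat. x + y - of_nat k * g \<in> H"
        by (intro exI[of _ "k + m"]) (simp add: algebra_simps)
    qed
    moreover have "H \<subseteq> ?H" by (auto intro: exI[of _ 0])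
    moreover have "g \<in> ?H" using H by (auto intro!: exI[of _ 1] simp: sub_def)
    ultimately have "?H = UNIV" using max[of ?H] g by blast
    then show ?thesis by blast
  qed
  \<comment> \<open>A multiplier prime to \<open>p\<close> is invertible modulo \<open>p\<close>,
    and its inverse would bring \<open>g\<close> itself into \<open>H\<close>.\<close>
  have dvd: "p dvd k" if "of_nat k * g \<in> H" for k
  proof (rule ccontr)
    assume "\<not> p dvd k"
    then have "coprime k p" using p by (metis coprime_commute prime_imp_coprime)
    then obtain m where "[k * m = Suc 0] (mod p)" using cong_solve_coprime_nat by blast
    then have "of_nat (k * m) = (of_nat (Suc 0) :: 'a)"
      by (simp only: of_nat_eq_iff_cong_CHAR p_def)
    then have "of_nat k * of_nat m = (1::'a)" by simp
    then have "g = of_nat m * (of_nat k * g)"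
      by (metis mult.assoc mult.commute mult_1)
    then show False using sub_mult[OF H(1) that, of m] g by argo
  qed
  define \<omega> where "\<omega> = cis (2 * pi / p)"
  have \<omega>p: "\<omega> ^ p = 1" using \<open>p > 0\<close> by (simp add: \<omega>_def Complex.DeMoivre)
  have \<omega>1: "\<omega> \<noteq> 1"
  proof
    assume "\<omega> = 1"
    then have "cos (2 * pi / p) = 1" by (simp add: \<omega>_def complex_eq_iff)
    then obtain m :: int where "2 * pi / p = real_of_int m * 2 * pi"
      unfolding cos_one_2pi_int by blast
    then have "real_of_int m * p = 1" using \<open>p > 0\<close> by (simp add: field_simps)
    then have "m * int p = 1" by (metis of_int_eq_1_iff of_int_mult of_int_of_nat_eq)
    then have "int p dvd 1" by (metis dvd_triv_right)
    then have "p = 1" by simp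
    then show False using p by simp
  qed
  define k where "k x = (SOME k::nat. x - of_nat k * g \<in> H)" for x
  have k: "x - of_nat (k x) * g \<in> H" for x
    unfolding k_def using someI_ex[OF ex] .
  \<comment> \<open>Exponents representing the same \<open>x\<close> differ by a multiple of
    \<open>p\<close>, so the arbitrary choice in \<open>k\<close> does no harm. The order is fixed
    because the difference is taken on naturals.\<close>
  have aux: "\<omega> ^ m = \<omega> ^ m'" if "x - of_nat m * g \<in> H" "x - of_nat m' * g \<in> H" "m \<le> m'" for x m m'
  proof -
    have "(x - of_nat m * g) + - (x - of_nat m' * g) \<in> H"
      using that H by (intro sub_add sub_uminus)
    then have "of_nat (m' - m) * g \<in> H" using that by (simp add: of_nat_diff algebra_simps)
    from dvd[OF this] obtain c where "m' - m = p * c" by (elim dvdE)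
    then have "m' = m + p * c" using that by simp
    then show ?thesis by (simp add: power_add power_mult \<omega>p)
  qed
  have \<psi>: "\<omega> ^ k x = \<omega> ^ m" if "x - of_nat m * g \<in> H" for x m
    using aux[OF that k, symmetric] aux[OF k that] by (rule linorder_le_cases)
  show ?thesis
  proof (rule that[of "\<lambda>x. \<omega> ^ k x" g])
    fix x y
    have "(x + y) - of_nat (k x + k y) * g \<in> H"
      using sub_add[OF H(1) k k, of x y] by (simp add: algebra_simps)
    from \<psi>[OF this] show "\<omega> ^ k (x + y) = \<omega> ^ k x * \<omega> ^ k y" by (simp add: power_add)
    have "0 - of_nat 0 * g \<in> H" using H by (simp add: sub_def)
    from \<psi>[OF this] show "\<omega> ^ k 0 = 1" by simp
    have "g - of_nat 1 * g \<in> H" using H by (simp add: sub_def)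
    from \<psi>[OF this] show "\<omega> ^ k g \<noteq> 1" using \<omega>1 by simp
  qed
qed

section \<open>Character sums over linearly independent rows\<close>

text \<open>A family over an index set, not a set of vectors: repeated rows count as dependent, and
  rows can be added one index at a time.\<close>

definition lin_indep_rows :: "'i set \<Rightarrow> ('i \<Rightarrow> 'a::field ^ 'l) \<Rightarrow> bool" where
  "lin_indep_rows I g \<longleftrightarrow> (\<forall>u. (\<Sum>i\<in>I. u i *s g i) = 0 \<longrightarrow> (\<forall>i\<in>I. u i = 0))"

definition rank_le_1 :: "'i set \<Rightarrow> ('i \<Rightarrow> 'a::field ^ 'l) \<Rightarrow> bool" where
  "rank_le_1 I B \<longleftrightarrow> (\<exists>z u. \<forall>i\<in>I. B i = u i *s z)"

lemma scalar_product_simps: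
  fixes a b c :: "'a::comm_ring_1 ^ 'l"
  shows "scalar_product (a + b) c = scalar_product a c + scalar_product b c"
    "scalar_product c (a + b) = scalar_product c a + scalar_product c b"
    "scalar_product (t *s a) c = t * scalar_product a c"
    "scalar_product c (t *s a) = t * scalar_product c a"
    "scalar_product 0 c = 0" "scalar_product c 0 = 0"
  by (auto simp: scalar_product_def algebra_simps sum.distrib sum_distrib_left)

lemma scalar_product_sum_right:
  fixes c :: "'a::comm_ring_1 ^ 'l"
  shows "scalar_product c (\<Sum>i\<in>I. f i) = (\<Sum>i\<in>I. scalar_product c (f i))"
  by (induction I rule: infinite_finite_induct) (auto simp: scalar_product_simps)

text \<open>A relation with nonzero coefficient at \<open>k\<close> can be solved for
  \<open>y\<close>. Coefficients are taken in \<open>I \<rightarrow>\<^sub>E UNIV\<close> so that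
  they are determined by their values on \<open>I\<close>.\<close>

lemma lin_indep_rows_insert:
  assumes "finite I" "k \<notin> I"
  shows "lin_indep_rows (insert k I) (g(k := y)) \<longleftrightarrow>
    lin_indep_rows I g \<and> y \<notin> (\<lambda>u. \<Sum>i\<in>I. u i *s g i) ` (I \<rightarrow>\<^sub>E UNIV)" (is "?L \<longleftrightarrow> ?R")
proof -
  have eq: "(\<Sum>i\<in>insert k I. u i *s (g(k := y)) i) = u k *s y + (\<Sum>i\<in>I. u i *s g i)" for u
    using assms by (auto intro!: sum.cong)
  show ?thesis
  proof
    assume L: ?L
    have "lin_indep_rows I g"
      unfolding lin_indep_rows_def
    proof (intro allI impI ballI)
      fix u i assume u: "(\<Sum>i\<in>I. u i *s g i) = 0" and i: "i \<in> I"
      have "(\<Sum>i\<in>I. (u(k := 0)) i *s g i) = (\<Sum>i\<in>I. u i *s g i)"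
        using assms by (intro sum.cong) auto
      then have "(\<Sum>i\<in>insert k I. (u(k := 0)) i *s (g(k := y)) i) = 0"
        unfolding eq using u by simp
      then have "(u(k := 0)) i = 0"
        using L i unfolding lin_indep_rows_def by blast
      then show "u i = 0" using i assms by (auto split: if_splits)
    qed
    moreover have "y \<noteq> (\<Sum>i\<in>I. u i *s g i)" for u
    proof
      assume y: "y = (\<Sum>i\<in>I. u i *s g i)"
      have "(\<Sum>i\<in>I. (u(k := -1)) i *s g i) = (\<Sum>i\<in>I. u i *s g i)"
        using assms by (intro sum.cong) auto
      then have "(\<Sum>i\<in>insert k I. (u(k := -1)) i *s (g(k := y)) i) = 0"
        unfolding eq using y by (simp add: vec_eq_iff)
      then have "(u(k := -1)) k = 0"
        using L unfolding lin_indep_rows_def by blast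
      then show False by simp
    qed
    ultimately show ?R by auto
  next
    assume R: ?R
    show ?L
      unfolding lin_indep_rows_def
    proof (intro allI impI)
      fix u assume "(\<Sum>i\<in>insert k I. u i *s (g(k := y)) i) = 0"
      then have u: "u k *s y + (\<Sum>i\<in>I. u i *s g i) = 0" unfolding eq .
      have "u k = 0"
      proof (rule ccontr)
        assume nz: "u k \<noteq> 0"
        define v where "v = restrict (\<lambda>i. - u i / u k) I"
        have "(\<Sum>i\<in>I. v i *s g i) = (\<Sum>i\<in>I. (- 1 / u k) *s (u i *s g i))"
          by (intro sum.cong) (auto simp: v_def vec_eq_iff)
        also have "\<dots> = (- 1 / u k) *s (\<Sum>i\<in>I. u i *s g i)"
          by (rule vec.scale_sum_right[symmetric])
        also have "(\<Sum>i\<in>I. u i *s g i) = - (u k *s y)"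
          using u by (simp add: add_eq_0_iff)
        finally have "y = (\<Sum>i\<in>I. v i *s g i)"
          using nz by (simp add: vec_eq_iff)
        moreover have "v \<in> I \<rightarrow>\<^sub>E UNIV" by (auto simp: v_def)
        ultimately show False using R by blast
      qed
      with u R show "\<forall>i\<in>insert k I. u i = 0"
        by (auto simp: lin_indep_rows_def)
    qed
  qed
qed

text \<open>The difference of two coefficient families is a relation. Injectivity allows a sum over
  the span of the rows to be taken over coefficients.\<close>

lemma lin_indep_rows_inj_on:
  assumes "lin_indep_rows I g"
  shows "inj_on (\<lambda>u. \<Sum>i\<in>I. u i *s g i) (I \<rightarrow>\<^sub>E UNIV)"
proof (rule inj_onI)
  fix u v assume uv: "u \<in> I \<rightarrow>\<^sub>E UNIV" "v \<in> I \<rightarrow>\<^sub>E UNIV"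
    and "(\<Sum>i\<in>I. u i *s g i) = (\<Sum>i\<in>I. v i *s g i)"
  then have "(\<Sum>i\<in>I. (u i - v i) *s g i) = 0"
    by (simp add: vec.scale_left_diff_distrib sum_subtractf)
  then have "\<forall>i\<in>I. u i - v i = 0" using assms unfolding lin_indep_rows_def by (elim allE[of _ "\<lambda>i. u i - v i"]) blast
  then show "u = v" using uv by (intro PiE_ext) auto
qed

locale additive_char =
  fixes \<psi> :: "'a::{field,finite} \<Rightarrow> complex"
  assumes \<psi>_add: "\<psi> (x + y) = \<psi> x * \<psi> y"
    and \<psi>_0 [simp]: "\<psi> 0 = 1"
    and \<psi>_nontrivial: "\<exists>g. \<psi> g \<noteq> 1"
begin

lemma \<psi>_sum: "\<psi> (\<Sum>i\<in>I. f i) = (\<Prod>i\<in>I. \<psi> (f i))"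
  by (induction I rule: infinite_finite_induct) (auto simp: \<psi>_add)

text \<open>Orthogonality of characters: for \<open>b \<noteq> 0\<close>, a vector supported at a
  nonzero coordinate of \<open>b\<close> gives the product any prescribed value, in particular one
  where \<open>\<psi>\<close> is not 1.\<close>

lemma sum_\<psi>_scalar_product:
  fixes b :: "'a ^ 'l::finite"
  shows "(\<Sum>y\<in>UNIV. \<psi> (scalar_product b y)) = (if b = 0 then of_nat (CARD('a) ^ CARD('l)) else 0)"
proof (cases "b = 0")
  case True
  then show ?thesis by (simp add: scalar_product_simps)
next
  case False
  then obtain j where j: "b $ j \<noteq> 0" by (auto simp: vec_eq_iff)
  obtain g where g: "\<psi> g \<noteq> 1" using \<psi>_nontrivial by blast
  have "scalar_product b (axis j (g / b $ j)) = (\<Sum>i\<in>UNIV. if i = j then g else 0)"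
    unfolding scalar_product_def by (intro sum.cong) (use j in \<open>auto simp: axis_def\<close>)
  also have "\<dots> = g" by simp
  finally have "\<psi> (scalar_product b (axis j (g / b $ j))) \<noteq> 1" using g by simp
  then have "(\<Sum>y\<in>UNIV. \<psi> (scalar_product b y)) = 0"
    by (intro sum_additive_char_eq_0) (auto simp: scalar_product_simps \<psi>_add)
  then show ?thesis using False by simp
qed

text \<open>
  For \<open>I\<close> the set of all row indices this is the eigenvalue of the disjointness matrix at the character given by \<open>B\<close>.
\<close>

definition indep_char_sum :: "'i set \<Rightarrow> ('i \<Rightarrow> 'a ^ 'l::finite) \<Rightarrow> complex" where
  "indep_char_sum I B = (\<Sum>g\<in>I \<rightarrow>\<^sub>E UNIV.
     if lin_indep_rows I g then \<Prod>i\<in>I. \<psi> (scalar_product (B i) (g i)) else 0)"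

text \<open>
  The new row ranges over everything outside the span of the other rows \<open>g\<close>; the sum over that span is
  parametrised by the coefficients \<open>u\<close>, and each of them shifts the character of the rows \<open>g\<close>.
\<close>

lemma indep_char_sum_insert:
  fixes B :: "'i \<Rightarrow> 'a ^ 'l::finite"
  assumes I: "finite I" "k \<notin> I"
  shows "indep_char_sum (insert k I) B =
    (if B k = 0 then of_nat (CARD('a) ^ CARD('l)) * indep_char_sum I B else 0)
    - (\<Sum>u\<in>I \<rightarrow>\<^sub>E UNIV. indep_char_sum I (\<lambda>i. B i + u i *s B k))"
proof -
  let ?im = "\<lambda>g. (\<lambda>u. \<Sum>i\<in>I. u i *s g i) ` (I \<rightarrow>\<^sub>E UNIV)"
  let ?P = "\<lambda>B g. \<Prod>i\<in>I. \<psi> (scalar_product (B i) (g i))"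
  let ?c = "\<lambda>y. \<psi> (scalar_product (B k) y)"
  let ?q = "of_nat (CARD('a) ^ CARD('l)) :: complex"
  have prod_upd: "(\<Prod>i\<in>insert k I. \<psi> (scalar_product (B i) ((g(k := y)) i))) = ?c y * ?P B g" for g y
    using I by (auto intro!: prod.cong)
  have inner: "(\<Sum>y\<in>UNIV. if y \<notin> ?im g then ?c y * ?P B g else 0) =
      (if B k = 0 then ?q else 0) * ?P B g
      - (\<Sum>u\<in>I \<rightarrow>\<^sub>E UNIV. ?P (\<lambda>i. B i + u i *s B k) g)" if g: "lin_indep_rows I g" for g
  proof -
    have "(\<Sum>y\<in>UNIV. if y \<notin> ?im g then ?c y * ?P B g else 0) = (\<Sum>y\<in>UNIV - ?im g. ?c y * ?P B g)"
      by (intro sum.mono_neutral_cong_right) auto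
    also have "\<dots> = (\<Sum>y\<in>UNIV. ?c y * ?P B g) - (\<Sum>y\<in>?im g. ?c y * ?P B g)"
      by (intro sum_diff) auto
    also have "(\<Sum>y\<in>UNIV. ?c y * ?P B g) = (if B k = 0 then ?q else 0) * ?P B g"
      by (simp only: sum_distrib_right[symmetric] sum_\<psi>_scalar_product)
    also have "(\<Sum>y\<in>?im g. ?c y * ?P B g) =
        (\<Sum>u\<in>I \<rightarrow>\<^sub>E UNIV. ?c (\<Sum>i\<in>I. u i *s g i) * ?P B g)"
      by (subst sum.reindex[OF lin_indep_rows_inj_on[OF g]]) (simp add: o_def)
    also have "\<dots> = (\<Sum>u\<in>I \<rightarrow>\<^sub>E UNIV. ?P (\<lambda>i. B i + u i *s B k) g)"
      by (intro sum.cong refl)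
        (simp add: scalar_product_sum_right \<psi>_sum scalar_product_simps \<psi>_add prod.distrib mult.commute)
    finally show ?thesis .
  qed
  have "indep_char_sum (insert k I) B = (\<Sum>(y, g)\<in>UNIV \<times> (I \<rightarrow>\<^sub>E UNIV).
      if lin_indep_rows I g \<and> y \<notin> ?im g then ?c y * ?P B g else 0)"
    unfolding indep_char_sum_def PiE_insert_eq
    by (subst sum.reindex[OF inj_combinator[OF I(2)]])
      (simp only: o_def case_prod_unfold lin_indep_rows_insert[OF I] prod_upd)
  also have "\<dots> = (\<Sum>y\<in>UNIV. \<Sum>g\<in>I \<rightarrow>\<^sub>E UNIV.
      if lin_indep_rows I g \<and> y \<notin> ?im g then ?c y * ?P B g else 0)"
    by (rule sum.cartesian_product[symmetric])
  also have "\<dots> = (\<Sum>g\<in>I \<rightarrow>\<^sub>E UNIV. \<Sum>y\<in>UNIV.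
      if lin_indep_rows I g \<and> y \<notin> ?im g then ?c y * ?P B g else 0)"
    by (rule sum.swap)
  also have "\<dots> = (\<Sum>g\<in>I \<rightarrow>\<^sub>E UNIV. if lin_indep_rows I g then
      (if B k = 0 then ?q else 0) * ?P B g - (\<Sum>u\<in>I \<rightarrow>\<^sub>E UNIV. ?P (\<lambda>i. B i + u i *s B k) g) else 0)"
  proof (intro sum.cong refl)
    fix g
    show "(\<Sum>y\<in>UNIV. if lin_indep_rows I g \<and> y \<notin> ?im g then ?c y * ?P B g else 0) =
      (if lin_indep_rows I g then (if B k = 0 then ?q else 0) * ?P B g
         - (\<Sum>u\<in>I \<rightarrow>\<^sub>E UNIV. ?P (\<lambda>i. B i + u i *s B k) g) else 0)"
      using inner[of g] by (cases "lin_indep_rows I g") simp_all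
  qed
  also have "\<dots> = (\<Sum>g\<in>I \<rightarrow>\<^sub>E UNIV. (if B k = 0 then ?q else 0) * (if lin_indep_rows I g then ?P B g else 0)
      - (\<Sum>u\<in>I \<rightarrow>\<^sub>E UNIV. if lin_indep_rows I g then ?P (\<lambda>i. B i + u i *s B k) g else 0))"
    by (intro sum.cong) auto
  also have "\<dots> = (if B k = 0 then ?q else 0) * indep_char_sum I B
      - (\<Sum>u\<in>I \<rightarrow>\<^sub>E UNIV. indep_char_sum I (\<lambda>i. B i + u i *s B k))"
    unfolding sum_subtractf indep_char_sum_def sum_distrib_left[symmetric]
    by (rule arg_cong2[of _ _ _ _ minus, OF refl sum.swap])
  finally show ?thesis by simp
qed

lemma indep_char_sum_empty [simp]: "indep_char_sum {} B = 1"
  by (simp add: indep_char_sum_def lin_indep_rows_def)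

end

section \<open>Eigenvalues of the disjointness matrix by rank\<close>

lemma CARD_field_gt_1: "CARD('a::{field,finite}) > 1"
proof -
  have "card {0, 1 :: 'a} \<le> CARD('a)" by (intro card_mono) auto
  then show ?thesis by simp
qed

text \<open>Up to sign this is \<open>\<lambda>\<^sub>1\<close>, in the form suited to the recursion; see \<open>disj_eigenvalue_0_1\<close>.\<close>

definition second_eigenvalue :: "nat \<Rightarrow> nat \<Rightarrow> nat \<Rightarrow> real" where
  "second_eigenvalue q l m = (\<Prod>i=1..<m. real q ^ l - real q ^ i)"

lemma second_eigenvalue_Suc:
  "m \<ge> 1 \<Longrightarrow> second_eigenvalue q l (Suc m) = (real q ^ l - real q ^ m) * second_eigenvalue q l m"
  by (simp add: second_eigenvalue_def)

lemma second_eigenvalue_pos: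
  assumes "q > 1" "m \<le> l"
  shows "second_eigenvalue q l m > 0"
  unfolding second_eigenvalue_def using assms
  by (intro prod_pos) (auto intro!: power_strict_increasing)

lemma rank_le_1_insert_0:
  assumes "B k = 0" "k \<notin> I"
  shows "rank_le_1 (insert k I) B \<longleftrightarrow> rank_le_1 I B"
proof
  assume "rank_le_1 I B"
  then obtain z u where "\<forall>i\<in>I. B i = u i *s z" by (auto simp: rank_le_1_def)
  then have "\<forall>i\<in>insert k I. B i = (u(k := 0)) i *s z" using assms by auto
  then show "rank_le_1 (insert k I) B" unfolding rank_le_1_def by blast
qed (auto simp: rank_le_1_def)

text \<open>A nonzero row can serve as the common direction \<open>z\<close>.\<close>

lemma rank_le_1_insert_nonzero:
  assumes "B k \<noteq> 0" "k \<notin> I"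
  shows "rank_le_1 (insert k I) B \<longleftrightarrow> (\<exists>v. \<forall>i\<in>I. B i = v i *s B k)"
proof
  assume "rank_le_1 (insert k I) B"
  then obtain z u where zu: "\<forall>i\<in>insert k I. B i = u i *s z" by (auto simp: rank_le_1_def)
  then have "B k = u k *s z" by simp
  with assms have "u k \<noteq> 0" by auto
  have "B i = (u i / u k) *s B k" if "i \<in> I" for i
    using zu that \<open>u k \<noteq> 0\<close> by (simp add: vec_eq_iff)
  then show "\<exists>v. \<forall>i\<in>I. B i = v i *s B k" by (intro exI[of _ "\<lambda>i. u i / u k"]) simp
next
  assume "\<exists>v. \<forall>i\<in>I. B i = v i *s B k"
  then obtain v where "\<forall>i\<in>I. B i = v i *s B k" by blast
  then have "\<forall>i\<in>insert k I. B i = (v(k := 1)) i *s B k" using assms by auto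
  then show "rank_le_1 (insert k I) B" unfolding rank_le_1_def by blast
qed

context additive_char
begin

text \<open>Induction on the number of rows by \<open>indep_char_sum_insert\<close>. The strict
  upper bound for fewer than \<open>l\<close> rows is what makes the lower bound strict after one
  more row, since it enters there with a minus sign.\<close>

lemma indep_char_sum_eigenvalue:
  fixes B :: "'i \<Rightarrow> 'a ^ 'l::finite"
  defines "q \<equiv> CARD('a)" and "l \<equiv> CARD('l)"
  assumes "finite I" "I \<noteq> {}" "card I \<le> l"
  shows "Im (indep_char_sum I B) = 0 \<and>
    ((\<forall>i\<in>I. B i = 0) \<longrightarrow> Re (indep_char_sum I B) = (real q ^ l - 1) * second_eigenvalue q l (card I)) \<and>
    (\<not> (\<forall>i\<in>I. B i = 0) \<longrightarrow> rank_le_1 I B \<longrightarrow> Re (indep_char_sum I B) = - second_eigenvalue q l (card I)) \<and>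
    (\<not> rank_le_1 I B \<longrightarrow>
       - second_eigenvalue q l (card I) < Re (indep_char_sum I B) \<and>
       Re (indep_char_sum I B) \<le> second_eigenvalue q l (card I) \<and>
       (card I < l \<longrightarrow> Re (indep_char_sum I B) < second_eigenvalue q l (card I)))"
  using assms(3-)
proof (induction I arbitrary: B rule: finite_ne_induct)
  case (singleton k)
  have "rank_le_1 {k} B" by (auto simp: rank_le_1_def intro!: exI[of _ "B k"] exI[of _ "\<lambda>_. 1"])
  moreover have "indep_char_sum {k} B = (if B k = 0 then of_nat (q ^ l) else 0) - 1"
    using indep_char_sum_insert[of "{}" k B] by (simp add: q_def l_def)
  ultimately show ?case by (auto simp: second_eigenvalue_def)
next
  case (insert k I)
  let ?S = "indep_char_sum I" and ?m = "card I"
  let ?\<Lambda> = "second_eigenvalue q l ?m"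
  \<comment> \<open>The ratio of consecutive values of \<open>second_eigenvalue\<close>. As
    \<open>q \<ge> 2\<close>, it is at least the number \<open>q ^ ?m\<close> of shifts
    \<open>u\<close>, and larger if \<open>Suc ?m < l\<close>.\<close>
  define D where "D = real q ^ l - real q ^ ?m"
  have m: "?m \<ge> 1" "Suc ?m \<le> l" "?m < l" "card (insert k I) = Suc ?m"
    using insert by (auto simp: Suc_le_eq card_gt_0_iff)
  have q: "q > 1" unfolding q_def by (rule CARD_field_gt_1)
  have \<Lambda>: "?\<Lambda> > 0" using second_eigenvalue_pos q m by simp
  have \<Lambda>': "second_eigenvalue q l (card (insert k I)) = D * ?\<Lambda>"
    using m by (simp add: second_eigenvalue_Suc D_def)
  have "real q ^ ?m * real q \<le> real q ^ l"
    using power_increasing[of "Suc ?m" l "real q"] m q by (simp add: mult.commute)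
  moreover have "real q ^ ?m * 2 \<le> real q ^ ?m * real q" using q by simp
  ultimately have D1: "real q ^ ?m \<le> D" unfolding D_def by linarith
  have D2: "real q ^ ?m < D" if "Suc ?m < l"
  proof -
    have "real q ^ Suc ?m < real q ^ l" using that q by (intro power_strict_increasing) auto
    with \<open>real q ^ ?m * 2 \<le> real q ^ ?m * real q\<close> show ?thesis unfolding D_def by (simp add: mult.commute)
  qed
  have qm: "real q ^ ?m > 0" using q by simp
  with D1 have D: "D > 0" by linarith
  have IH: "Im (?S B) = 0"
    "\<forall>i\<in>I. B i = 0 \<Longrightarrow> Re (?S B) = (real q ^ l - 1) * ?\<Lambda>"
    "\<not> (\<forall>i\<in>I. B i = 0) \<Longrightarrow> rank_le_1 I B \<Longrightarrow> Re (?S B) = - ?\<Lambda>"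
    "\<not> rank_le_1 I B \<Longrightarrow> - ?\<Lambda> < Re (?S B)"
    "\<not> rank_le_1 I B \<Longrightarrow> Re (?S B) < ?\<Lambda>" for B :: "'i \<Rightarrow> 'a ^ 'l"
    using insert.IH[of B] m by auto
  have card_PiE: "card (I \<rightarrow>\<^sub>E (UNIV :: 'a set)) = q ^ ?m"
    using insert.hyps by (simp add: card_PiE q_def)
  have rec: "indep_char_sum (insert k I) B =
    (if B k = 0 then of_nat (q ^ l) * ?S B else 0) - (\<Sum>u\<in>I \<rightarrow>\<^sub>E UNIV. ?S (\<lambda>i. B i + u i *s B k))"
    unfolding q_def l_def using insert.hyps by (intro indep_char_sum_insert) auto
  have fin: "finite (I \<rightarrow>\<^sub>E (UNIV :: 'a set))" using insert.hyps by (intro finite_PiE) auto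
  show ?case
  proof (cases "B k = 0")
    case True
    \<comment> \<open>A zero new row makes every shift trivial, so the recursion just multiplies by
      \<open>D\<close>.\<close>
    have S: "indep_char_sum (insert k I) B = of_real D * ?S B"
      using True by (simp add: rec card_PiE D_def algebra_simps)
    have 0: "(\<forall>i\<in>insert k I. B i = 0) \<longleftrightarrow> (\<forall>i\<in>I. B i = 0)" using True by simp
    have r: "rank_le_1 (insert k I) B \<longleftrightarrow> rank_le_1 I B"
      using True insert.hyps(3) by (intro rank_le_1_insert_0)
    have Re: "Re (indep_char_sum (insert k I) B) = D * Re (?S B)" and Im: "Im (indep_char_sum (insert k I) B) = 0"
      using IH(1)[of B] by (simp_all add: S)
    have "- (D * ?\<Lambda>) < D * Re (?S B)" "D * Re (?S B) < D * ?\<Lambda>" if "\<not> rank_le_1 I B"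
      using mult_strict_left_mono[OF IH(4)[OF that] D] mult_strict_left_mono[OF IH(5)[OF that] D] by simp_all
    moreover have "D * Re (?S B) = (real q ^ l - 1) * (D * ?\<Lambda>)" if "\<forall>i\<in>I. B i = 0"
      using IH(2)[OF that] by simp
    moreover have "D * Re (?S B) = - (D * ?\<Lambda>)" if "\<not> (\<forall>i\<in>I. B i = 0)" "rank_le_1 I B"
      using IH(3)[OF that] by simp
    ultimately show ?thesis
      unfolding 0 r Re Im \<Lambda>' by (meson less_imp_le)
  next
    case False
    note Bk = False
    define s where "s u = Re (?S (\<lambda>i. B i + u i *s B k))" for u
    have Re: "Re (indep_char_sum (insert k I) B) = - (\<Sum>u\<in>I \<rightarrow>\<^sub>E UNIV. s u)"
      using rec False by (simp add: s_def)
    have Im: "Im (indep_char_sum (insert k I) B) = 0"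
      using rec False IH(1) by simp
    have r: "rank_le_1 (insert k I) B \<longleftrightarrow> (\<exists>v. \<forall>i\<in>I. B i = v i *s B k)"
      using False insert.hyps(3) by (intro rank_le_1_insert_nonzero)
    \<comment> \<open>Exactly one shift, \<open>w = - v\<close>, makes all rows zero and contributes
      \<open>(q ^ l - 1) * ?\<Lambda>\<close>; the other \<open>q ^ ?m - 1\<close> shifts have rank
      one and contribute \<open>- ?\<Lambda>\<close> each.\<close>
    have part1: "- (\<Sum>u\<in>I \<rightarrow>\<^sub>E UNIV. s u) = - (D * ?\<Lambda>)" if v: "\<forall>i\<in>I. B i = v i *s B k" for v
    proof -
      define w where "w = restrict (\<lambda>i. - v i) I"
      have w: "w \<in> I \<rightarrow>\<^sub>E UNIV" by (auto simp: w_def)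
      have "s u = - ?\<Lambda>" if u: "u \<in> (I \<rightarrow>\<^sub>E UNIV) - {w}" for u
      proof -
        have eq: "B i + u i *s B k = (v i + u i) *s B k" if "i \<in> I" for i
          using v that by (metis vec.scale_left_distrib)
        have rk: "rank_le_1 I (\<lambda>i. B i + u i *s B k)"
          unfolding rank_le_1_def by (intro exI[of _ "B k"] exI[of _ "\<lambda>i. v i + u i"] ballI eq)
        have nz: "\<not> (\<forall>i\<in>I. B i + u i *s B k = 0)"
        proof
          assume "\<forall>i\<in>I. B i + u i *s B k = 0"
          then have "v i + u i = 0" if "i \<in> I" for i
            using eq[OF that] that False by (metis vec.scale_eq_0_iff)
          then have "u i = w i" if "i \<in> I" for i
            using that by (simp add: w_def eq_neg_iff_add_eq_0 add.commute)
          then have "u = w" using u w by (intro PiE_ext) auto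
          then show False using u by simp
        qed
        show ?thesis unfolding s_def by (rule IH(3)[OF nz rk])
      qed
      then have "(\<Sum>u\<in>(I \<rightarrow>\<^sub>E UNIV) - {w}. s u) = (real q ^ ?m - 1) * (- ?\<Lambda>)"
        using fin w q by (simp add: card_PiE card_Diff_singleton of_nat_diff)
      moreover have "s w = (real q ^ l - 1) * ?\<Lambda>"
        unfolding s_def by (intro IH(2)) (use v in \<open>auto simp: w_def vec_eq_iff\<close>)
      ultimately show ?thesis
        using sum.remove[OF fin w, of s] by (simp add: D_def algebra_simps)
    qed
    \<comment> \<open>No shift vanishes, so each of the \<open>q ^ ?m\<close> terms is at least
      \<open>- ?\<Lambda>\<close> and less than \<open>?\<Lambda>\<close>, and
      \<open>q ^ ?m \<le> D\<close>.\<close>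
    have part2: "- (D * ?\<Lambda>) < - (\<Sum>u\<in>I \<rightarrow>\<^sub>E UNIV. s u) \<and> - (\<Sum>u\<in>I \<rightarrow>\<^sub>E UNIV. s u) \<le> D * ?\<Lambda> \<and>
        (Suc ?m < l \<longrightarrow> - (\<Sum>u\<in>I \<rightarrow>\<^sub>E UNIV. s u) < D * ?\<Lambda>)"
      if nr: "\<nexists>v. \<forall>i\<in>I. B i = v i *s B k"
    proof -
      have s: "- ?\<Lambda> \<le> s u \<and> s u < ?\<Lambda>" for u
      proof -
        have nz: "\<not> (\<forall>i\<in>I. B i + u i *s B k = 0)"
        proof
          assume "\<forall>i\<in>I. B i + u i *s B k = 0"
          then have "\<forall>i\<in>I. B i = (- u i) *s B k" by (simp add: eq_neg_iff_add_eq_0)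
          then have "\<exists>v. \<forall>i\<in>I. B i = v i *s B k" by (rule exI[of _ "\<lambda>i. - u i"])
          with nr show False ..
        qed
        show ?thesis
        proof (cases "rank_le_1 I (\<lambda>i. B i + u i *s B k)")
          case True
          show ?thesis unfolding s_def IH(3)[OF nz True] using \<Lambda> by simp
        next
          case False
          show ?thesis unfolding s_def using IH(4,5)[OF False] by simp
        qed
      qed
      have ne: "I \<rightarrow>\<^sub>E (UNIV :: 'a set) \<noteq> {}" by (simp add: PiE_eq_empty_iff)
      have "(\<Sum>u\<in>I \<rightarrow>\<^sub>E UNIV. s u) < (\<Sum>u\<in>I \<rightarrow>\<^sub>E (UNIV :: 'a set). ?\<Lambda>)"
        using s fin ne by (intro sum_strict_mono) auto
      then have up: "(\<Sum>u\<in>I \<rightarrow>\<^sub>E UNIV. s u) < real q ^ ?m * ?\<Lambda>" by (simp add: card_PiE)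
      have "(\<Sum>u\<in>I \<rightarrow>\<^sub>E (UNIV :: 'a set). - ?\<Lambda>) \<le> (\<Sum>u\<in>I \<rightarrow>\<^sub>E UNIV. s u)"
        using s by (intro sum_mono) auto
      then have lo: "- (real q ^ ?m * ?\<Lambda>) \<le> (\<Sum>u\<in>I \<rightarrow>\<^sub>E UNIV. s u)" by (simp add: card_PiE)
      have "real q ^ ?m * ?\<Lambda> \<le> D * ?\<Lambda>" using D1 \<Lambda> by simp
      moreover have "real q ^ ?m * ?\<Lambda> < D * ?\<Lambda>" if "Suc ?m < l" using D2[OF that] \<Lambda> by simp
      ultimately show ?thesis using up lo by fastforce
    qed
    show ?thesis
    proof (cases "\<exists>v. \<forall>i\<in>I. B i = v i *s B k")
      case True
      then obtain v where "\<forall>i\<in>I. B i = v i *s B k" by blast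
      from part1[OF this] show ?thesis
        unfolding r Re Im \<Lambda>' using Bk True by simp
    next
      case False
      from part2[OF this] show ?thesis
        unfolding r Re Im \<Lambda>' unfolding m(4) using Bk False by simp
    qed
  qed
qed

end

section \<open>A field structure on a finite vector space\<close>

text \<open>The shift by 1 permutes the field, so the added ones sum to zero.\<close>

lemma of_nat_CARD_eq_0: "of_nat CARD('a::{field,finite}) = (0::'a)"
proof -
  have "(\<Sum>x\<in>UNIV. x + 1 :: 'a) = (\<Sum>x\<in>UNIV. x)"
    by (rule sum.reindex_bij_witness[of _ "\<lambda>x. x - 1" "\<lambda>x. x + 1"]) auto
  then show ?thesis by (simp add: sum.distrib)
qed

text \<open>Multiplication by \<open>x \<noteq> 0\<close> permutes the nonzero elements; comparing
  their products gives \<open>x ^ (q - 1) = 1\<close>.\<close>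

lemma power_CARD_eq_self: "x ^ CARD('a) = (x::'a::{field,finite})"
proof (cases "x = 0")
  case False
  let ?U = "UNIV - {0::'a}"
  have "(\<Prod>y\<in>?U. x * y) = (\<Prod>y\<in>?U. y)"
    by (rule prod.reindex_bij_witness[of _ "\<lambda>y. inverse x * y" "\<lambda>y. x * y"])
      (use False in \<open>auto simp: field_simps\<close>)
  then have "x ^ card ?U = 1" by (simp add: prod.distrib)
  moreover have "CARD('a) = Suc (card ?U)"
    using card_Suc_Diff1[of "UNIV :: 'a set" 0] by simp
  ultimately show ?thesis by (simp only: power_Suc mult_1_right)
qed (simp add: card_gt_0_iff)

text \<open>
  \<open>(X + 1)\<^sup>q - X\<^sup>q - 1\<close> has degree less than \<open>q\<close> and vanishes on the \<open>q\<close> elements of the base field, so it is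
  zero; this avoids writing \<open>q\<close> as a prime power.
\<close>

lemma frobenius_add:
  fixes x y :: "'a::{field,finite} alg_closure"
  shows "(x + y) ^ CARD('a) = x ^ CARD('a) + y ^ CARD('a)"
proof (cases "y = 0")
  case True
  then show ?thesis by (simp add: power_0_left)
next
  case False
  define q where "q = CARD('a)"
  have q: "q > 0" by (simp add: q_def)
  define P :: "'a alg_closure poly" where "P = [:1, 1:] ^ q - monom 1 q - 1"
  have deg: "Polynomial.degree ([:1, 1 :: 'a alg_closure:] ^ q) = q"
    by (subst degree_power_eq) auto
  have lead: "poly.coeff ([:1, 1 :: 'a alg_closure:] ^ q) q = 1"
    using lead_coeff_power[of "[:1, 1 :: 'a alg_closure:]" q] deg by simp
  have "P = 0"
  proof (rule ccontr)
    assume "P \<noteq> 0"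
    have "poly.coeff P i = 0" if "i \<ge> q" for i
    proof (cases "i = q")
      case True
      then show ?thesis using lead q by (simp add: P_def)
    next
      case False
      with that have "i > q" by simp
      then show ?thesis using deg q by (simp add: P_def coeff_eq_0)
    qed
    then have "Polynomial.degree P < q"
      using \<open>P \<noteq> 0\<close> by (metis leading_coeff_0_iff not_less)
    moreover have "poly P (to_ac a) = 0" for a
    proof -
      have "poly P (to_ac a) = to_ac ((1 + a) ^ q - a ^ q - 1)"
        by (simp add: P_def poly_monom)
      then show ?thesis unfolding q_def power_CARD_eq_self by simp
    qed
    then have "card (range (to_ac :: 'a \<Rightarrow> _)) \<le> card {x. poly P x = 0}"
      by (intro card_mono poly_roots_finite \<open>P \<noteq> 0\<close>) auto
    moreover have "card (range (to_ac :: 'a \<Rightarrow> _)) = q"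
      unfolding q_def by (rule card_image[OF inj_to_ac])
    ultimately show False
      using card_poly_roots_bound[OF \<open>P \<noteq> 0\<close>] by linarith
  qed
  \<comment> \<open>Evaluating at \<open>x / y\<close> and multiplying by \<open>y ^ q\<close> gives
    the identity in two variables.\<close>
  then have "poly P (x / y) = 0" by simp
  then have "(1 + x / y) ^ q = (x / y) ^ q + 1" by (simp add: P_def poly_monom algebra_simps)
  moreover have "x + y = y * (1 + x / y)" "x = y * (x / y)" using False by (simp_all add: distrib_left)
  ultimately show ?thesis
    unfolding q_def[symmetric] by (metis power_mult_distrib distrib_left mult_1_right)
qed

lemma frobenius_power_add:
  fixes x y :: "'a::{field,finite} alg_closure"
  shows "(x + y) ^ (CARD('a) ^ k) = x ^ (CARD('a) ^ k) + y ^ (CARD('a) ^ k)"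
  by (induction k arbitrary: x y) (simp_all add: power_mult frobenius_add)

text \<open>The polynomial splits into linear factors, and a repeated factor would give a common
  root with the derivative.\<close>

lemma card_roots_alg_closed:
  fixes p :: "'b::alg_closed_field poly"
  assumes "p \<noteq> 0" and sep: "\<And>x. poly p x = 0 \<Longrightarrow> poly (pderiv p) x \<noteq> 0"
  shows "card {x. poly p x = 0} = Polynomial.degree p"
proof -
  obtain A where A: "size A = Polynomial.degree p"
    and p: "p = smult (lead_coeff p) (\<Prod>x\<in>#A. [:-x, 1:])"
    using alg_closed_imp_factorization[OF \<open>p \<noteq> 0\<close>] by blast
  define c where "c = lead_coeff p"
  have c: "c \<noteq> 0" "p = smult c (\<Prod>x\<in>#A. [:-x, 1:])" using \<open>p \<noteq> 0\<close> p by (simp_all add: c_def)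
  have roots: "poly p x = 0 \<longleftrightarrow> x \<in># A" for x
    unfolding c(2) using c(1) by (auto simp: poly_prod_mset)
  have "count A x = 1" if "x \<in># A" for x
  proof (rule ccontr)
    assume "count A x \<noteq> 1"
    obtain A' where A': "A = add_mset x A'" using multi_member_split \<open>x \<in># A\<close> by metis
    with \<open>count A x \<noteq> 1\<close> have "x \<in># A'" by (auto simp: count_eq_zero_iff)
    then obtain A'' where A'': "A' = add_mset x A''" using multi_member_split by metis
    have r: "p = [:-x, 1:] * ([:-x, 1:] * smult c (\<Prod>x\<in>#A''. [:-x, 1:]))"
      unfolding c(2) A' A'' by simp
    have "poly (pderiv p) x = 0" unfolding r pderiv_mult by simp
    moreover have "poly p x = 0" by (simp add: r)
    ultimately show False using sep by blast
  qed
  then have "size A = card (set_mset A)"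
    by (simp add: size_multiset_overloaded_eq)
  then show ?thesis using A roots by simp
qed

text \<open>With \<open>Q = q ^ k\<close>, the polynomial \<open>X ^ Q - X\<close> has derivative -1
  because \<open>Q\<close> is zero in the field, so its roots are simple.\<close>

lemma card_frobenius_fixed:
  assumes "k > 0"
  shows "card {x :: 'a::{field,finite} alg_closure. x ^ (CARD('a) ^ k) = x} = CARD('a) ^ k"
proof -
  define Q where "Q = CARD('a) ^ k"
  have "Q > 1" unfolding Q_def using CARD_field_gt_1[where 'a='a] assms by (intro one_less_power)
  define p :: "'a alg_closure poly" where "p = monom 1 Q - monom 1 1"
  have deg: "Polynomial.degree p = Q"
    unfolding p_def diff_conv_add_uminus using \<open>Q > 1\<close>
    by (subst degree_add_eq_left) (auto simp: degree_monom_eq)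
  have "of_nat Q = (0 :: 'a alg_closure)"
    unfolding Q_def using of_nat_CARD_eq_0[where 'a='a] assms
    by (metis of_nat_power to_ac_0 to_ac_of_nat zero_power)
  then have "poly (pderiv p) x = - 1" for x
    by (simp add: p_def pderiv_diff pderiv_monom poly_monom)
  moreover have "p \<noteq> 0" using deg \<open>Q > 1\<close> by auto
  ultimately have "card {x. poly p x = 0} = Q"
    using card_roots_alg_closed[of p] deg \<open>Q > 1\<close> by auto
  then show ?thesis by (simp add: p_def poly_monom Q_def)
qed

text \<open>The solutions of \<open>x ^ Q = x\<close>, with \<open>Q = q ^ l\<close>, in the
  algebraic closure form a field that is an \<open>l\<close>-dimensional space over the base field;
  its multiplication is carried over along coordinates.\<close>

lemma ex_division_mult:
  obtains mul :: "'a::{field,finite} ^ 'l::finite \<Rightarrow> 'a ^ 'l \<Rightarrow> 'a ^ 'l"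
  where "\<And>x y z. mul (x + y) z = mul x z + mul y z"
    "\<And>x y z. mul x (y + z) = mul x y + mul x z"
    "\<And>x c y. mul x (c *s y) = c *s mul x y"
    "\<And>x y. mul x y = 0 \<Longrightarrow> x = 0 \<or> y = 0"
proof -
  define Q where "Q = CARD('a) ^ CARD('l)"
  define K where "K = {x :: 'a alg_closure. x ^ Q = x}"
  have card_K: "card K = Q" unfolding K_def Q_def by (rule card_frobenius_fixed) simp
  have "Q > 0" by (simp add: Q_def)
  have fin_K: "finite K" using card_K \<open>Q > 0\<close> by (metis card.infinite less_numeral_extra(3))
  have K_add: "x + y \<in> K" if "x \<in> K" "y \<in> K" for x y
    using that by (simp add: K_def Q_def frobenius_power_add)
  have K_mult: "x * y \<in> K" if "x \<in> K" "y \<in> K" for x y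
    using that by (simp add: K_def power_mult_distrib)
  have "a ^ (CARD('a) ^ k) = a" for a :: 'a and k
    by (induction k) (simp_all add: power_mult power_CARD_eq_self)
  then have K_to_ac: "to_ac a \<in> K" for a by (simp add: K_def Q_def flip: to_ac_power)
  have K_0: "0 \<in> K" using K_to_ac[of 0] by simp
  interpret V: vector_space "\<lambda>(c::'a) x. to_ac c * x"
    by unfold_locales (auto simp: algebra_simps)
  have K_sub: "V.subspace K"
    unfolding V.subspace_def using K_0 K_add K_mult K_to_ac by blast
  obtain B where B: "B \<subseteq> K" "V.independent B" "K \<subseteq> V.span B"
    using V.basis_exists[of K] by metis
  have fin_B: "finite B" using B fin_K finite_subset by blast
  let ?comb = "\<lambda>c. \<Sum>b\<in>B. to_ac (c b) * b"
  have span: "V.span B = K"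
    using B K_sub V.span_minimal by blast
  have inj: "inj_on ?comb (B \<rightarrow>\<^sub>E UNIV)"
  proof (rule inj_onI)
    fix c d assume cd: "c \<in> B \<rightarrow>\<^sub>E UNIV" "d \<in> B \<rightarrow>\<^sub>E UNIV" and "?comb c = ?comb d"
    then have "(\<Sum>b\<in>B. to_ac (c b - d b) * b) = 0"
      by (simp add: left_diff_distrib sum_subtractf)
    then have "c b - d b = 0" if "b \<in> B" for b
      using V.independentD[OF B(2) fin_B order_refl, of "\<lambda>b. c b - d b"] that by simp
    then show "c = d" using cd by (intro PiE_ext) auto
  qed
  have im: "?comb ` (B \<rightarrow>\<^sub>E UNIV) = K"
  proof -
    have "?comb c = ?comb (restrict c B)" for c by (intro sum.cong) auto
    moreover have "restrict c B \<in> B \<rightarrow>\<^sub>E UNIV" for c :: "_ \<Rightarrow> 'a" by auto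
    ultimately have "?comb ` (B \<rightarrow>\<^sub>E UNIV) = range ?comb" by blast
    then show ?thesis using V.span_finite[OF fin_B] span by simp
  qed
  \<comment> \<open>Counting coefficient families over the basis gives
    \<open>q ^ card B = q ^ l\<close>, so the dimension is \<open>l\<close>.\<close>
  have "card (B \<rightarrow>\<^sub>E (UNIV :: 'a set)) = Q"
    using card_image[OF inj] by (simp add: im card_K)
  then have "CARD('a) ^ card B = CARD('a) ^ CARD('l)"
    using fin_B by (simp add: card_PiE Q_def)
  then have "card B = CARD('l)"
    using CARD_field_gt_1[where 'a='a] power_inject_exp by blast
  then obtain h where h: "bij_betw h (UNIV :: 'l set) B"
    using fin_B finite_same_card_bij by (metis finite)
  \<comment> \<open>Coordinates in the basis, now indexed by \<open>'l\<close>: injective by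
    independence, onto \<open>K\<close> by counting.\<close>
  define \<phi> where "\<phi> v = (\<Sum>j\<in>UNIV. to_ac (v $ j) * h j)" for v :: "'a ^ 'l"
  have \<phi>_add: "\<phi> (v + w) = \<phi> v + \<phi> w" for v w
    by (simp add: \<phi>_def algebra_simps sum.distrib)
  have \<phi>_scale: "\<phi> (c *s v) = to_ac c * \<phi> v" for c v
    by (simp add: \<phi>_def sum_distrib_left)
  have "\<phi> ` UNIV \<subseteq> K"
  proof clarify
    fix v
    have "\<phi> v \<in> V.span B"
      unfolding \<phi>_def using h by (intro V.span_sum V.span_scale V.span_base) (auto simp: bij_betw_def)
    then show "\<phi> v \<in> K" using span by simp
  qed
  moreover have inj: "inj \<phi>"
  proof (rule injI)
    fix v w assume "\<phi> v = \<phi> w"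
    then have "0 = (\<Sum>j\<in>UNIV. to_ac (v $ j - w $ j) * h j)"
      by (simp add: \<phi>_def left_diff_distrib sum_subtractf)
    also have "\<dots> = (\<Sum>b\<in>B. to_ac (v $ (inv_into UNIV h b) - w $ (inv_into UNIV h b)) * b)"
      by (subst sum.reindex_bij_betw[OF h, symmetric]) (use h in \<open>simp add: bij_betw_def\<close>)
    finally have "v $ (inv_into UNIV h b) - w $ (inv_into UNIV h b) = 0" if "b \<in> B" for b
      using V.independentD[OF B(2) fin_B order_refl, of "\<lambda>b. v $ (inv_into UNIV h b) - w $ (inv_into UNIV h b)"] that by simp
    then have "v $ j = w $ j" for j
      using h by (metis bij_betw_def inv_into_f_f UNIV_I rangeI right_minus_eq)
    then show "v = w" by (simp add: vec_eq_iff)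
  qed
  moreover have "card (range \<phi>) = card K"
    using card_image[OF inj] card_K by (simp add: Q_def)
  ultimately have bij: "bij_betw \<phi> UNIV K"
    using fin_K by (simp add: bij_betw_def card_subset_eq)
  define \<phi>' where "\<phi>' = inv_into UNIV \<phi>"
  have \<phi>': "\<phi> (\<phi>' x) = x" if "x \<in> K" for x
    using bij that by (simp add: \<phi>'_def bij_betw_inv_into_right)
  have \<phi>K: "\<phi> v \<in> K" for v using bij by (auto simp: bij_betw_def)
  define mul where "mul x y = \<phi>' (\<phi> x * \<phi> y)" for x y
  have mul: "\<phi> (mul x y) = \<phi> x * \<phi> y" for x y
    by (simp add: mul_def \<phi>' K_mult \<phi>K)
  have \<phi>_0: "\<phi> 0 = 0" by (simp add: \<phi>_def)
  show ?thesis
  proof (rule that[of mul])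
    fix x y z :: "'a ^ 'l" and c
    show "mul (x + y) z = mul x z + mul y z"
      by (rule injD[OF inj]) (simp only: mul \<phi>_add distrib_left distrib_right)
    show "mul x (y + z) = mul x y + mul x z"
      by (rule injD[OF inj]) (simp only: mul \<phi>_add distrib_left distrib_right)
    show "mul x (c *s y) = c *s mul x y"
      by (rule injD[OF inj]) (simp only: mul \<phi>_scale mult.left_commute)
    assume "mul x y = 0"
    then have "\<phi> x * \<phi> y = 0" using mul[of x y] \<phi>_0 by simp
    then show "x = 0 \<or> y = 0" using injD[OF inj, of x 0] injD[OF inj, of y 0] \<phi>_0 by auto
  qed
qed

section \<open>Members of the attenuated space as graphs of matrices\<close>

definition vpair :: "'a ^ 'n::finite \<Rightarrow> 'a ^ 'l::finite \<Rightarrow> 'a ^ ('n + 'l)" where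
  "vpair u w = (\<chi> k. case k of Inl i \<Rightarrow> u $ i | Inr j \<Rightarrow> w $ j)"

definition vleft :: "'a ^ ('n::finite + 'l::finite) \<Rightarrow> 'a ^ 'n" where
  "vleft v = (\<chi> i. v $ Inl i)"

lemma vpair_nth [simp]: "vpair u w $ Inl i = u $ i" "vpair u w $ Inr j = w $ j"
  by (simp_all add: vpair_def)

lemma vec_sum_eq_iff: "v = w \<longleftrightarrow> (\<forall>i. v $ Inl i = w $ Inl i) \<and> (\<forall>j. v $ Inr j = w $ Inr j)"
  by (metis vec_eq_iff old.sum.exhaust)

lemma vpair_inject [simp]: "vpair u w = vpair u' w' \<longleftrightarrow> u = u' \<and> w = w'"
  by (simp add: vec_sum_eq_iff) (simp add: vec_eq_iff)

lemma vpair_exhaust: obtains u w where "v = vpair u w"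
  by (rule that[of "\<chi> i. v $ Inl i" "\<chi> j. v $ Inr j"]) (simp add: vec_sum_eq_iff)

lemma vleft_vpair [simp]: "vleft (vpair u w) = u"
  by (simp add: vleft_def vec_eq_iff)

lemma vpair_0: "vpair 0 0 = 0"
  by (simp add: vec_sum_eq_iff)

lemma vleft_0 [simp]: "vleft 0 = 0"
  by (simp add: vleft_def vec_eq_iff)

lemma linear_vleft: "Vector_Spaces.linear (*s) (*s) (vleft :: 'a::field ^ ('n::finite + 'l::finite) \<Rightarrow> _)"
  by (simp add: Vector_Spaces.linear_iff vec.vector_space_axioms vleft_def vec_eq_iff)

lemma att_E_iff: "v \<in> att_E \<longleftrightarrow> vleft v = 0"
proof
  assume "vleft v = 0"
  then have v: "v $ Inl i = 0" for i by (simp add: vleft_def vec_eq_iff)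
  have "v = (\<Sum>j\<in>UNIV. v $ Inr j *s axis (Inr j) 1)"
    by (simp add: vec_sum_eq_iff v axis_def if_distrib cong: if_cong)
  also have "\<dots> \<in> att_E"
    unfolding att_E_def by (intro vec.span_sum vec.span_scale vec.span_base) auto
  finally show "v \<in> att_E" .
qed (simp add: vleft_def vec_eq_iff att_E_Inl)

definition mgraph :: "'a::field ^ 'l::finite ^ 'n::finite \<Rightarrow> ('a ^ ('n + 'l)) set" where
  "mgraph A = range (\<lambda>u. vpair u (u v* A))"

lemma vpair_mem_mgraph [simp]: "vpair u w \<in> mgraph A \<longleftrightarrow> w = u v* A"
  by (auto simp: mgraph_def)

lemma linear_mgraph:
  fixes A :: "'a::field ^ 'l::finite ^ 'n::finite"
  shows "Vector_Spaces.linear (*s) (*s) (\<lambda>u. vpair u (u v* A))"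
  by (simp add: Vector_Spaces.linear_iff vec.vector_space_axioms vec_sum_eq_iff
      vector_matrix_left_distrib scalar_vector_matrix_assoc)

lemma mgraph_mem_att_subspaces:
  fixes A :: "'a::{field,finite} ^ 'l::finite ^ 'n::finite"
  shows "mgraph A \<in> att_subspaces CARD('n)"
proof -
  have "vec.subspace (mgraph A)"
    unfolding mgraph_def by (rule vec.linear_subspace_image[OF linear_mgraph vec.subspace_UNIV])
  moreover have "vec.dim (mgraph A) = CARD('n)"
    unfolding mgraph_def by (subst vec.dim_image_eq[OF linear_mgraph]) (auto simp: inj_on_def card_cart_basis)
  moreover have "mgraph A \<inter> att_E = {0}"
    by (auto simp: mgraph_def att_E_iff vpair_0 intro!: image_eqI[of _ _ 0])
  ultimately show ?thesis by (simp add: att_subspaces_def)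
qed

text \<open>Projection to the first \<open>n\<close> coordinates has kernel \<open>att_E\<close>, so
  it is injective on \<open>U\<close> and, by dimension, onto; the rows of \<open>A\<close> are read
  off from the preimages of the unit vectors.\<close>

lemma att_subspaces_imp_mgraph:
  fixes U :: "('a::{field,finite} ^ ('n::finite + 'l::finite)) set"
  assumes "U \<in> att_subspaces CARD('n)"
  obtains A where "U = mgraph A"
proof -
  have U: "vec.subspace U" "vec.dim U = CARD('n)" "U \<inter> att_E = {0}"
    using assms by (auto simp: att_subspaces_def)
  have inj: "x = y" if "x \<in> U" "y \<in> U" "vleft x = vleft y" for x y
  proof -
    have "x - y \<in> U" using that U(1) by (intro vec.subspace_diff)
    moreover have "vleft (x - y) = 0" using that(3) by (simp add: vleft_def vec_eq_iff)
    ultimately have "x - y \<in> U \<inter> att_E" by (simp add: att_E_iff)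
    then show ?thesis using U by auto
  qed
  have "vec.span U = U" using U by simp
  then have "inj_on vleft (vec.span U)" using inj by (simp only: inj_on_def) blast
  then have "vec.dim (vleft ` U) = vec.dim U" by (rule vec.dim_image_eq[OF linear_vleft])
  then have "vec.span (vleft ` U) = UNIV"
    using U by (intro vec.dim_eq_full[THEN iffD1]) (simp add: vec.dimension_def card_cart_basis)
  then have surj: "vleft ` U = UNIV"
    using vec.span_eq_iff[THEN iffD2, OF vec.linear_subspace_image[OF linear_vleft U(1)]] by metis
  have "\<exists>v. v \<in> U \<and> vleft v = axis i 1" for i
  proof -
    have "axis i 1 \<in> vleft ` U" unfolding surj by simp
    then show ?thesis by auto
  qed
  then have "\<exists>f. \<forall>i. f i \<in> U \<and> vleft (f i) = axis i 1" by (intro choice allI)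
  then obtain f where "\<forall>i. f i \<in> U \<and> vleft (f i) = axis i 1" by (rule exE)
  then have f: "f i \<in> U" "vleft (f i) = axis i 1" for i by simp_all
  define A :: "'a ^ 'l ^ 'n" where "A = (\<chi> i j. f i $ Inr j)"
  have f_left: "f i $ Inl k = (if k = i then 1 else 0)" for i k
  proof -
    have "f i $ Inl k = vleft (f i) $ k" by (simp add: vleft_def)
    then show ?thesis unfolding f(2) by (simp add: axis_def)
  qed
  have "vpair u (u v* A) = (\<Sum>i\<in>UNIV. u $ i *s f i)" for u
  proof -
    have "(\<Sum>i\<in>UNIV. u $ i * f i $ Inl k) = (\<Sum>i\<in>UNIV. if i = k then u $ i else 0)" for k
      by (intro sum.cong) (auto simp: f_left)
    then show ?thesis by (simp add: vec_sum_eq_iff A_def vector_matrix_mult_def)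
  qed
  also have "(\<Sum>i\<in>UNIV. u $ i *s f i) \<in> U" for u
    using U f by (intro vec.subspace_sum vec.subspace_scale) auto
  finally have sub: "vpair u (u v* A) \<in> U" for u .
  have "U = mgraph A"
  proof
    show "mgraph A \<subseteq> U" using sub by (auto simp: mgraph_def)
    show "U \<subseteq> mgraph A"
    proof
      fix v assume "v \<in> U"
      then have "v = vpair (vleft v) (vleft v v* A)" using sub by (intro inj) auto
      then show "v \<in> mgraph A" by (metis mgraph_def rangeI)
    qed
  qed
  then show ?thesis by (rule that)
qed

definition graph_n :: "'a::{field,finite} ^ 'l::finite ^ 'n::finite \<Rightarrow> ('a, 'n, 'l) att_n" where
  "graph_n A = Abs_att_n (mgraph A)"

lemma Rep_graph_n [simp]: "Rep_att_n (graph_n A) = mgraph A"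
  by (simp add: graph_n_def Abs_att_n_inverse mgraph_mem_att_subspaces)

lemma vec_mult_eq_sum: "u v* A = (\<Sum>i\<in>UNIV. u $ i *s A $ i)"
  by (simp add: vec_eq_iff vector_matrix_mult_def mult.commute)

lemma mgraph_inject: "mgraph A = mgraph B \<longleftrightarrow> A = (B :: 'a::field ^ 'l::finite ^ 'n::finite)"
proof
  assume "mgraph A = mgraph B"
  then have "axis i 1 v* A = axis i 1 v* B" for i
    by (metis vpair_mem_mgraph)
  moreover have "axis i 1 v* A = A $ i" for i and A :: "'a ^ 'l ^ 'n"
  proof -
    have "(\<Sum>k\<in>UNIV. axis i 1 $ k * A $ k $ j) = (\<Sum>k\<in>UNIV. if k = i then A $ k $ j else 0)" for j
      by (intro sum.cong) (auto simp: axis_def)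
    then show ?thesis by (simp add: vec_eq_iff vector_matrix_mult_def)
  qed
  ultimately have "A $ i = B $ i" for i by metis
  then show "A = B" by (simp add: vec_eq_iff)
qed simp

text \<open>Turns sums over the type \<open>att_n\<close> into sums over matrices.\<close>

lemma bij_graph_n: "bij (graph_n :: 'a::{field,finite} ^ 'l::finite ^ 'n::finite \<Rightarrow> _)"
proof (rule bijI)
  show "inj (graph_n :: 'a ^ 'l ^ 'n \<Rightarrow> _)"
    by (rule injI) (metis Rep_graph_n mgraph_inject)
  show "surj (graph_n :: 'a ^ 'l ^ 'n \<Rightarrow> _)"
  proof (rule surjI)
    fix \<pi> :: "('a, 'n, 'l) att_n"
    show "graph_n (SOME A. Rep_att_n \<pi> = mgraph A) = \<pi>"
      using att_subspaces_imp_mgraph[OF Rep_att_n[of \<pi>]]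
      by (metis (mono_tags, lifting) Rep_att_n_inject Rep_graph_n someI_ex)
  qed
qed

lemma lin_indep_rows_UNIV:
  "lin_indep_rows UNIV (($) A) \<longleftrightarrow> (\<forall>u. u v* A = 0 \<longrightarrow> u = 0)"
  (is "?L \<longleftrightarrow> ?R")
proof
  assume ?L
  then show ?R by (auto simp: lin_indep_rows_def vec_mult_eq_sum vec_eq_iff)
next
  assume R: ?R
  show ?L
    unfolding lin_indep_rows_def
  proof (intro allI impI ballI)
    fix u i assume "(\<Sum>i\<in>UNIV. u i *s A $ i) = 0"
    then have "(\<chi> i. u i) v* A = 0" by (simp add: vec_mult_eq_sum)
    with R have "(\<chi> i. u i) = 0" by blast
    then show "u i = 0" by (simp add: vec_eq_iff)
  qed
qed

text \<open>A common vector of the two graphs comes from a \<open>u\<close> with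
  \<open>uA = uB\<close>, that is, from a relation among the rows of \<open>A - B\<close>.\<close>

lemma att_disjoint_graph_n:
  "att_disjoint (graph_n A) (graph_n B) \<longleftrightarrow> lin_indep_rows UNIV (($) (A - B))"
proof -
  have "mgraph A \<inter> mgraph B = {0} \<longleftrightarrow> (\<forall>u. u v* A = u v* B \<longrightarrow> u = 0)"
  proof
    assume AB: "mgraph A \<inter> mgraph B = {0}"
    show "\<forall>u. u v* A = u v* B \<longrightarrow> u = 0"
    proof (intro allI impI)
      fix u assume "u v* A = u v* B"
      then have "vpair u (u v* A) \<in> mgraph A \<inter> mgraph B" by simp
      then have "vpair u (u v* A) = vpair 0 0" using AB by (simp add: vpair_0)
      then show "u = 0" by simp
    qed
  next
    assume *: "\<forall>u. u v* A = u v* B \<longrightarrow> u = 0"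
    have "0 \<in> mgraph A \<inter> mgraph B" by (simp flip: vpair_0)
    moreover have "v = 0" if "v \<in> mgraph A \<inter> mgraph B" for v
    proof -
      obtain u w where v: "v = vpair u w" by (rule vpair_exhaust)
      with that have w: "w = u v* A" "w = u v* B" by auto
      then have "u = 0" using * by metis
      then show ?thesis using v w by (simp add: vpair_0)
    qed
    ultimately show "mgraph A \<inter> mgraph B = {0}" by blast
  qed
  then show ?thesis
    by (simp add: att_disjoint_def lin_indep_rows_UNIV vector_matrix_mult_diff_rdistrib)
qed

lemma span_vpair_subset_iff:
  fixes A :: "'a::{field,finite} ^ 'l::finite ^ 'n::finite"
  shows "vec.span {vpair u w} \<subseteq> mgraph A \<longleftrightarrow> w = u v* A"
proof -
  have "vec.subspace (mgraph A)"
    using mgraph_mem_att_subspaces[of A] by (simp add: att_subspaces_def)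
  then have "vec.span {vpair u w} \<subseteq> mgraph A \<longleftrightarrow> vpair u w \<in> mgraph A"
    using vec.span_minimal[of "{vpair u w}" "mgraph A"] vec.span_base[of "vpair u w" "{vpair u w}"] by blast
  then show ?thesis by simp
qed

lemma dim_1_imp_span:
  fixes P :: "('a::field ^ 'm::finite) set"
  assumes "vec.subspace P" "vec.dim P = 1"
  obtains v where "v \<noteq> 0" "P = vec.span {v}"
proof -
  obtain B where B: "B \<subseteq> P" "vec.independent B" "P \<subseteq> vec.span B" "card B = 1"
    using vec.basis_exists[of P] assms by metis
  then obtain v where "B = {v}" by (auto simp: card_1_singleton_iff)
  moreover have "vec.span B = P" using B assms vec.span_minimal by blast
  ultimately show ?thesis using B that[of v] by auto
qed

lemma span_vpair_mem_att_subspaces: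
  fixes u :: "'a::{field,finite} ^ 'n::finite" and w :: "'a ^ 'l::finite"
  assumes "u \<noteq> 0"
  shows "vec.span {vpair u w} \<in> att_subspaces 1"
proof -
  have nz: "vpair u w \<noteq> 0" using assms by (metis vpair_0 vpair_inject)
  have "v = 0" if "v \<in> vec.span {vpair u w}" "v \<in> att_E" for v
  proof -
    from that(1) obtain c where c: "v = c *s vpair u w" by (auto simp: vec.span_singleton)
    with that(2) have "c *s u = 0" by (simp add: att_E_iff vleft_def vec_eq_iff)
    with assms c show ?thesis by simp
  qed
  moreover have "0 \<in> vec.span {vpair u w} \<inter> att_E" by (simp add: vec.span_zero att_E_def)
  moreover have "vec.dim (vec.span {vpair u w}) = 1"
    using nz vec.dim_eq_card_independent[of "{vpair u w}"] by simp
  ultimately show ?thesis by (auto simp: att_subspaces_def)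
qed

section \<open>Fourier analysis of the disjointness matrix\<close>

text \<open>Those \<open>C\<close> for which \<open>u \<mapsto> uC\<close> is injective: the
  connection set of the Cayley graph of disjointness.\<close>

definition injective_matrices :: "('a::field ^ 'l::finite ^ 'n::finite) set" where
  "injective_matrices = {C. lin_indep_rows UNIV (($) C)}"

lemma injective_matrices_iff: "C \<in> injective_matrices \<longleftrightarrow> (\<forall>u. u v* C = 0 \<longrightarrow> u = 0)"
  by (simp add: injective_matrices_def lin_indep_rows_UNIV)

text \<open>The disjointness matrix in matrix coordinates, as a convolution; see
  \<open>disj_matrix_mult\<close>.\<close>

definition disj_sum :: "('a::{field,finite} ^ 'l::finite ^ 'n::finite \<Rightarrow> real) \<Rightarrow> 'a ^ 'l ^ 'n \<Rightarrow> real" where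
  "disj_sum f A = (\<Sum>C\<in>injective_matrices. f (A - C))"

lemma bij_betw_minus: "bij_betw (\<lambda>C. A - C) UNIV (UNIV :: 'b::ab_group_add set)"
  by (rule bij_betw_byWitness[of _ "\<lambda>C. A - C"]) auto

lemma disj_matrix_mult:
  fixes v :: "real ^ ('a::{field,finite}, 'n::finite, 'l::finite) att_n"
  shows "(disj_matrix *v v) $ graph_n A = disj_sum (\<lambda>A. v $ graph_n A) A"
proof -
  have "(disj_matrix *v v) $ graph_n A =
      (\<Sum>\<sigma>\<in>UNIV. if att_disjoint (graph_n A) \<sigma> then v $ \<sigma> else 0)"
    by (simp add: disj_matrix_def matrix_vector_mult_def if_distrib if_distribR cong: if_cong)
  also have "\<dots> = (\<Sum>A'\<in>UNIV. if A - A' \<in> injective_matrices then v $ graph_n A' else 0)"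
    by (subst sum.reindex_bij_betw[OF bij_graph_n, symmetric])
      (simp add: att_disjoint_graph_n injective_matrices_def)
  also have "\<dots> = (\<Sum>C\<in>UNIV. if C \<in> injective_matrices then v $ graph_n (A - C) else 0)"
    by (subst sum.reindex_bij_betw[OF bij_betw_minus[of A], symmetric]) simp
  also have "\<dots> = disj_sum (\<lambda>A. v $ graph_n A) A"
    unfolding disj_sum_def by (intro sum.mono_neutral_cong_right) auto
  finally show ?thesis .
qed

lemma all_att_n_iff: "(\<forall>\<pi>. P \<pi>) \<longleftrightarrow> (\<forall>A. P (graph_n A))"
  by (metis bij_graph_n bij_pointE)

lemma disj_eigenspace_iff:
  "v \<in> disj_eigenspace j \<longleftrightarrow> (\<forall>A. disj_sum (\<lambda>A. v $ graph_n A) A =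
     disj_eigenvalue CARD('a) CARD('n) CARD('l) j * v $ graph_n A)"
  for v :: "real ^ ('a::{field,finite}, 'n::finite, 'l::finite) att_n"
  by (simp add: disj_eigenspace_def vec_eq_iff[of "disj_matrix *v v"] all_att_n_iff disj_matrix_mult)

lemma sum_Suc_choose_two: "(\<Sum>i=1..<n. i) = n choose 2"
proof (induction n)
  case (Suc n)
  then show ?case by (cases "n = 0") (simp_all add: numeral_2_eq_2)
qed simp

text \<open>Each factor is \<open>q ^ i * (q ^ (l - i) - 1)\<close>, the exponents \<open>i\<close>
  add up to \<open>n choose 2\<close>, and the product is reversed by \<open>s = n - i\<close>;
  \<open>n \<le> l\<close> makes the truncated differences exact.\<close>

lemma second_eigenvalue_eq:
  assumes "n \<le> l"
  shows "second_eigenvalue q l n = real q ^ (n choose 2) * (\<Prod>s=1..n-1. real q ^ (l - n + s) - 1)"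
proof -
  have "second_eigenvalue q l n = (\<Prod>i=1..<n. real q ^ i * (real q ^ (l - i) - 1))"
    unfolding second_eigenvalue_def using assms
    by (intro prod.cong) (auto simp: algebra_simps simp flip: power_add)
  also have "\<dots> = real q ^ (n choose 2) * (\<Prod>i=1..<n. real q ^ (l - i) - 1)"
    by (simp only: prod.distrib power_sum[symmetric] sum_Suc_choose_two)
  also have "(\<Prod>i=1..<n. real q ^ (l - i) - 1) = (\<Prod>s=1..n-1. real q ^ (l - n + s) - 1)"
    using assms by (intro prod.reindex_bij_witness[of _ "\<lambda>s. n - s" "\<lambda>i. n - i"]) auto
  finally show ?thesis .
qed

lemma disj_eigenvalue_0_1:
  assumes "1 \<le> n" "n \<le> l"
  shows "disj_eigenvalue q n l 0 = (real q ^ l - 1) * second_eigenvalue q l n"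
    "disj_eigenvalue q n l 1 = - second_eigenvalue q l n"
proof -
  \<comment> \<open>The factor at \<open>s = n\<close> is \<open>q ^ l - 1\<close>; it is present
    for \<open>j = 0\<close> and absent for \<open>j = 1\<close>.\<close>
  have "{1..n} = insert n {1..n - 1}" using assms by auto
  then have "(\<Prod>s=1..n. real q ^ (l - n + s) - 1) =
      (real q ^ l - 1) * (\<Prod>s=1..n-1. real q ^ (l - n + s) - 1)"
    using assms by simp
  then show "disj_eigenvalue q n l 0 = (real q ^ l - 1) * second_eigenvalue q l n"
    using assms by (simp add: disj_eigenvalue_def second_eigenvalue_eq)
qed (use assms in \<open>simp add: disj_eigenvalue_def second_eigenvalue_eq\<close>)

section \<open>Characters of the additive group of matrices\<close>

definition frobenius_product :: "'a::comm_ring_1 ^ 'l ^ 'n::finite \<Rightarrow> 'a ^ 'l ^ 'n \<Rightarrow> 'a" where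
  "frobenius_product B A = (\<Sum>i\<in>UNIV. scalar_product (B $ i) (A $ i))"

lemma frobenius_product_simps:
  "frobenius_product (B + B') A = frobenius_product B A + frobenius_product B' A"
  "frobenius_product B (A + A') = frobenius_product B A + frobenius_product B A'"
  "frobenius_product (- B) A = - frobenius_product B A"
  "frobenius_product B (A - A') = frobenius_product B A - frobenius_product B A'"
  by (simp_all add: frobenius_product_def scalar_product_def sum.distrib sum_negf sum_subtractf algebra_simps)

text \<open>At a \<open>B\<close> of rank at most one, the character sees \<open>A\<close> only
  through \<open>uA\<close>.\<close>

lemma frobenius_product_rank_1:
  fixes B A :: "'a::field ^ 'l::finite ^ 'n::finite"
  assumes "\<And>i. B $ i = u $ i *s z"
  shows "frobenius_product B A = scalar_product z (u v* A)"
  by (simp add: frobenius_product_def assms vec_mult_eq_sum scalar_product_sum_right scalar_product_simps)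

text \<open>The coefficient vector can be made nonzero even for \<open>B = 0\<close>, by a unit
  vector with \<open>z = 0\<close>, so that \<open>(u, w)\<close> always spans a member of the
  attenuated space.\<close>

lemma rank_le_1_UNIV_cases:
  fixes B :: "'a::field ^ 'l ^ 'n::finite"
  assumes "rank_le_1 UNIV (($) B)"
  obtains u z where "u \<noteq> 0" "\<And>i. B $ i = u $ i *s z"
proof -
  obtain z v where v: "B $ i = v i *s z" for i
    using assms by (auto simp: rank_le_1_def)
  show ?thesis
  proof (cases "(\<chi> i. v i) = 0")
    case True
    then have "B $ i = axis undefined 1 $ i *s 0" for i by (simp add: v vec_eq_iff)
    then show ?thesis by (rule that[rotated]) simp
  next
    case False
    then show ?thesis by (rule that[of _ z]) (simp add: v)
  qed
qed

lemma rank_le_1_uminus: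
  fixes B :: "'a::field ^ 'l ^ 'n::finite"
  shows "rank_le_1 UNIV (($) B) \<Longrightarrow> rank_le_1 UNIV (($) (- B))"
  unfolding rank_le_1_def
proof (elim exE)
  fix z u assume "\<forall>i\<in>UNIV. B $ i = u i *s z"
  then have "\<forall>i\<in>UNIV. (- B) $ i = (- u i) *s z" by simp
  then show "\<exists>z u. \<forall>i\<in>UNIV. (- B) $ i = u i *s z" by (intro exI[of _ z] exI[of _ "\<lambda>i. - u i"])
qed

context additive_char
begin

definition fourier :: "('a ^ 'l::finite ^ 'n::finite \<Rightarrow> real) \<Rightarrow> 'a ^ 'l ^ 'n \<Rightarrow> complex" where
  "fourier f B = (\<Sum>A\<in>UNIV. of_real (f A) * \<psi> (frobenius_product B A))"

lemma sum_\<psi>_frobenius_product: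
  fixes A :: "'a ^ 'l::finite ^ 'n::finite"
  shows "(\<Sum>B\<in>UNIV. \<psi> (frobenius_product B A)) = (if A = 0 then of_nat CARD('a ^ 'l ^ 'n) else 0)"
proof (cases "A = 0")
  case True
  then show ?thesis by (simp add: frobenius_product_def scalar_product_simps)
next
  case False
  then obtain i where "A $ i \<noteq> 0" by (auto simp: vec_eq_iff)
  then obtain j where ij: "A $ i $ j \<noteq> 0" by (auto simp: vec_eq_iff)
  obtain g where g: "\<psi> g \<noteq> 1" using \<psi>_nontrivial by blast
  let ?B = "axis i (axis j (g / A $ i $ j)) :: 'a ^ 'l ^ 'n"
  have "scalar_product (axis j (g / A $ i $ j)) (A $ i) = (\<Sum>k\<in>UNIV. if k = j then g else 0)"
    unfolding scalar_product_def by (intro sum.cong) (use ij in \<open>auto simp: axis_def\<close>)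
  then have sp: "scalar_product (axis j (g / A $ i $ j)) (A $ i) = g" by simp
  have "frobenius_product ?B A = (\<Sum>k\<in>UNIV. if k = i then g else 0)"
    unfolding frobenius_product_def
    by (intro sum.cong) (use sp in \<open>auto simp: axis_def scalar_product_simps\<close>)
  then have "\<psi> (frobenius_product ?B A) \<noteq> 1" using g by simp
  then have "(\<Sum>B\<in>UNIV. \<psi> (frobenius_product B A)) = 0"
    by (intro sum_additive_char_eq_0) (auto simp: frobenius_product_simps \<psi>_add)
  then show ?thesis using False by simp
qed

text \<open>Summing over \<open>B\<close> first leaves only \<open>A = A'\<close>. Evaluation at
  \<open>- B\<close> takes the place of complex conjugation.\<close>

lemma fourier_parseval:
  fixes f g :: "'a ^ 'l::finite ^ 'n::finite \<Rightarrow> real"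
  shows "(\<Sum>B\<in>UNIV. fourier f B * fourier g (- B)) = of_nat CARD('a ^ 'l ^ 'n) * of_real (\<Sum>A\<in>UNIV. f A * g A)"
proof -
  have "(\<Sum>B\<in>UNIV. fourier f B * fourier g (- B)) =
      (\<Sum>B\<in>UNIV. \<Sum>A\<in>UNIV. \<Sum>A'\<in>UNIV. of_real (f A * g A') * \<psi> (frobenius_product B (A - A')))"
    unfolding fourier_def sum_product
    by (intro sum.cong refl)
      (simp add: frobenius_product_simps mult_ac \<psi>_add[symmetric])
  also have "\<dots> = (\<Sum>A\<in>UNIV. \<Sum>A'\<in>UNIV. \<Sum>B\<in>UNIV. of_real (f A * g A') * \<psi> (frobenius_product B (A - A')))"
    by (subst sum.swap) (intro sum.cong refl sum.swap)
  also have "\<dots> = (\<Sum>A\<in>UNIV. \<Sum>A'\<in>UNIV. if A' = A then of_real (f A * g A) * of_nat CARD('a ^ 'l ^ 'n) else 0)"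
    unfolding sum_distrib_left[symmetric] sum_\<psi>_frobenius_product by (intro sum.cong) auto
  also have "\<dots> = (\<Sum>A\<in>UNIV. of_real (f A * g A) * of_nat CARD('a ^ 'l ^ 'n))"
    by (intro sum.cong refl) (simp add: sum.delta)
  finally show ?thesis
    by (simp only: sum_distrib_left of_real_sum mult.commute)
qed

lemma indep_char_sum_UNIV:
  fixes B :: "'a ^ 'l::finite ^ 'n::finite"
  shows "indep_char_sum UNIV (($) B) = (\<Sum>C\<in>injective_matrices. \<psi> (frobenius_product B C))"
proof -
  have [simp]: "($) (vec_lambda a) = a" for a :: "'n \<Rightarrow> 'a ^ 'l" by auto
  have "indep_char_sum UNIV (($) B) =
      (\<Sum>C\<in>UNIV. if C \<in> injective_matrices then \<psi> (frobenius_product B C) else 0)"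
    unfolding indep_char_sum_def
    by (rule sum.reindex_bij_witness[of _ "($)" vec_lambda])
      (auto simp: injective_matrices_def frobenius_product_def \<psi>_sum)
  also have "\<dots> = (\<Sum>C\<in>injective_matrices. \<psi> (frobenius_product B C))"
    by (intro sum.mono_neutral_cong_right) auto
  finally show ?thesis .
qed

text \<open>A convolution becomes a product: substituting \<open>A + C\<close> for \<open>A\<close>
  splits off the character value at \<open>C\<close>.\<close>

lemma fourier_disj_sum:
  fixes B :: "'a ^ 'l::finite ^ 'n::finite"
  shows "fourier (disj_sum f) B = indep_char_sum UNIV (($) B) * fourier f B"
proof -
  have "fourier (disj_sum f) B =
      (\<Sum>A\<in>UNIV. \<Sum>C\<in>injective_matrices. of_real (f (A - C)) * \<psi> (frobenius_product B A))"
    by (simp add: fourier_def disj_sum_def sum_distrib_right)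
  also have "\<dots> = (\<Sum>C\<in>injective_matrices. \<Sum>A\<in>UNIV. of_real (f (A - C)) * \<psi> (frobenius_product B A))"
    by (rule sum.swap)
  also have "\<dots> = (\<Sum>C\<in>injective_matrices. \<Sum>A\<in>UNIV. of_real (f A) * \<psi> (frobenius_product B (A + C)))"
  proof (rule sum.cong[OF refl])
    fix C
    show "(\<Sum>A\<in>UNIV. complex_of_real (f (A - C)) * \<psi> (frobenius_product B A)) =
        (\<Sum>A\<in>UNIV. of_real (f A) * \<psi> (frobenius_product B (A + C)))"
      by (rule sum.reindex_bij_witness[of _ "\<lambda>A. A + C" "\<lambda>A. A - C"]) auto
  qed
  also have "\<dots> = (\<Sum>C\<in>injective_matrices. \<psi> (frobenius_product B C) * fourier f B)"
    by (intro sum.cong refl) (simp add: fourier_def frobenius_product_simps \<psi>_add sum_distrib_left mult_ac)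
  finally show ?thesis by (simp add: indep_char_sum_UNIV sum_distrib_right)
qed

text \<open>The character at \<open>B\<close> is constant on each class of matrices with the same
  \<open>uA\<close>, and \<open>f\<close> sums to zero over each class.\<close>

lemma fourier_eq_0_if_rank_le_1:
  fixes B :: "'a ^ 'l::finite ^ 'n::finite"
  assumes "rank_le_1 UNIV (($) B)"
    and f: "\<And>u w. u \<noteq> 0 \<Longrightarrow> (\<Sum>A | u v* A = w. f A) = 0"
  shows "fourier f B = 0"
proof -
  obtain u z where u: "u \<noteq> 0" and B: "\<And>i. B $ i = u $ i *s z"
    using rank_le_1_UNIV_cases[OF assms(1)] by metis
  have "fourier f B = (\<Sum>w\<in>UNIV. \<Sum>A | u v* A = w. of_real (f A) * \<psi> (frobenius_product B A))"
    unfolding fourier_def by (subst sum.group[of UNIV UNIV "\<lambda>A. u v* A", symmetric]) auto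
  also have "\<dots> = (\<Sum>w\<in>UNIV. \<Sum>A | u v* A = w. of_real (f A) * \<psi> (scalar_product z w))"
    by (intro sum.cong refl) (simp add: frobenius_product_rank_1[OF B])
  also have "\<dots> = (\<Sum>w\<in>UNIV. of_real (\<Sum>A | u v* A = w. f A) * \<psi> (scalar_product z w))"
    by (simp add: sum_distrib_right)
  also have "\<dots> = 0" using f[OF u] by simp
  finally show ?thesis .
qed

text \<open>The strict lower bound excludes \<open>\<lambda>\<^sub>1\<close>. The upper bound
  excludes \<open>\<lambda>\<^sub>0\<close> once \<open>q ^ l - 1 > 1\<close>, and this holds since
  rank at least two forces \<open>2 \<le> n \<le> l\<close>.\<close>

lemma indep_char_sum_rank_ge_2:
  fixes B :: "'a ^ 'l::finite ^ 'n::finite"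
  assumes "CARD('n) \<le> CARD('l)" "\<not> rank_le_1 UNIV (($) B)" "j \<in> {0, 1}"
  shows "indep_char_sum UNIV (($) B) \<noteq> of_real (disj_eigenvalue CARD('a) CARD('n) CARD('l) j)"
proof
  let ?\<Lambda> = "second_eigenvalue CARD('a) CARD('l) CARD('n)"
  assume "indep_char_sum UNIV (($) B) = of_real (disj_eigenvalue CARD('a) CARD('n) CARD('l) j)"
  then have Re: "Re (indep_char_sum UNIV (($) B)) = disj_eigenvalue CARD('a) CARD('n) CARD('l) j" by simp
  have bounds: "- ?\<Lambda> < Re (indep_char_sum UNIV (($) B))" "Re (indep_char_sum UNIV (($) B)) \<le> ?\<Lambda>"
    using indep_char_sum_eigenvalue[of UNIV "($) B"] assms by auto
  have n: "1 \<le> CARD('n)" by (simp add: Suc_le_eq)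
  have "CARD('n) \<noteq> 1"
  proof
    assume "CARD('n) = 1"
    then obtain k :: 'n where k: "(UNIV :: 'n set) = {k}" by (auto simp: card_1_singleton_iff)
    then have "rank_le_1 UNIV (($) B)"
      unfolding rank_le_1_def by (auto intro!: exI[of _ "B $ k"] exI[of _ "\<lambda>_. 1"])
    with assms show False by blast
  qed
  then have l: "2 \<le> CARD('l)" using n assms(1) by linarith
  have "2 ^ 2 \<le> real CARD('a) ^ 2"
    using CARD_field_gt_1[where 'a='a] by (intro power_mono) auto
  also have "\<dots> \<le> real CARD('a) ^ CARD('l)"
    using CARD_field_gt_1[where 'a='a] l by (intro power_increasing) auto
  finally have "1 < real CARD('a) ^ CARD('l) - 1" by simp
  moreover have "?\<Lambda> > 0"
    using second_eigenvalue_pos[OF CARD_field_gt_1[where 'a='a] assms(1)] .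
  ultimately have lt: "?\<Lambda> < (real CARD('a) ^ CARD('l) - 1) * ?\<Lambda>" by simp
  note ev = disj_eigenvalue_0_1[OF n assms(1), of "CARD('a)"]
  from assms(3) consider "j = 0" | "j = 1" by blast
  then show False
  proof cases
    case 1
    then have "Re (indep_char_sum UNIV (($) B)) = (real CARD('a) ^ CARD('l) - 1) * ?\<Lambda>"
      using Re ev(1) by (simp only:)
    then show False using bounds lt by linarith
  next
    case 2
    then have "Re (indep_char_sum UNIV (($) B)) = - ?\<Lambda>"
      using Re ev(2) by (simp only:)
    then show False using bounds by linarith
  qed
qed

end

text \<open>Every term of Parseval's sum vanishes: the transform of \<open>g\<close> for rank at
  most one, and otherwise that of \<open>f\<close>, which would be scaled by two different
  factors.\<close>

lemma disj_sum_eigenfunction_orthogonal: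
  fixes f g :: "'a::{field,finite} ^ 'l::finite ^ 'n::finite \<Rightarrow> real"
  assumes "CARD('n) \<le> CARD('l)" "j \<in> {0, 1}"
    and f: "\<And>A. disj_sum f A = disj_eigenvalue CARD('a) CARD('n) CARD('l) j * f A"
    and g: "\<And>u w. u \<noteq> 0 \<Longrightarrow> (\<Sum>A | u v* A = w. g A) = 0"
  shows "(\<Sum>A\<in>UNIV. f A * g A) = 0"
proof -
  obtain \<psi> :: "'a \<Rightarrow> complex" and t where "\<And>x y. \<psi> (x + y) = \<psi> x * \<psi> y" "\<psi> 0 = 1" "\<psi> t \<noteq> 1"
    by (rule additive_char_exists) blast
  then interpret additive_char \<psi> by unfold_locales auto
  let ?ev = "disj_eigenvalue CARD('a) CARD('n) CARD('l) j"
  have "fourier f B * fourier g (- B) = 0" for B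
  proof (cases "rank_le_1 UNIV (($) B)")
    case True
    then show ?thesis using fourier_eq_0_if_rank_le_1[OF rank_le_1_uminus g] by simp
  next
    case False
    have "fourier (disj_sum f) B = of_real ?ev * fourier f B"
      by (simp add: fourier_def f sum_distrib_left mult.assoc)
    then have "(indep_char_sum UNIV (($) B) - of_real ?ev) * fourier f B = 0"
      by (simp add: fourier_disj_sum left_diff_distrib)
    then show ?thesis using indep_char_sum_rank_ge_2[OF assms(1) False assms(2)] by simp
  qed
  then have "of_nat CARD('a ^ 'l ^ 'n) * complex_of_real (\<Sum>A\<in>UNIV. f A * g A) = 0"
    unfolding fourier_parseval[symmetric] by (simp only: sum.neutral_const)
  then show ?thesis by (simp del: of_real_sum of_real_mult)
qed

text \<open>This is the value of the character sum at the trivial character,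
  \<open>B = 0\<close>.\<close>

lemma card_injective_matrices:
  assumes "CARD('n) \<le> CARD('l)"
  shows "real (card (injective_matrices :: ('a::{field,finite} ^ 'l::finite ^ 'n::finite) set)) =
    (real CARD('a) ^ CARD('l) - 1) * second_eigenvalue CARD('a) CARD('l) CARD('n)"
proof -
  obtain \<psi> :: "'a \<Rightarrow> complex" and t where "\<And>x y. \<psi> (x + y) = \<psi> x * \<psi> y" "\<psi> 0 = 1" "\<psi> t \<noteq> 1"
    by (rule additive_char_exists) blast
  then interpret additive_char \<psi> by unfold_locales auto
  have "indep_char_sum UNIV (($) (0 :: 'a ^ 'l ^ 'n)) = of_nat (card (injective_matrices :: ('a ^ 'l ^ 'n) set))"
    unfolding indep_char_sum_UNIV by (simp add: frobenius_product_def scalar_product_simps)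
  then show ?thesis
    using indep_char_sum_eigenvalue[of UNIV "($) (0 :: 'a ^ 'l ^ 'n)"] assms by simp
qed

section \<open>Spreads and switching sets\<close>

text \<open>The kernel is the orthogonal complement of the range of the adjoint, and complementing a
  subspace twice returns it.\<close>

lemma range_transpose_eq_orthogonal_comp:
  fixes M :: "real ^ 'm::finite ^ 'k::finite"
  shows "range (\<lambda>y. transpose M *v y) = orthogonal_comp {v. M *v v = 0}"
proof -
  have adj: "adjoint ((*v) M) = (*v) (transpose M)" by (rule adjoint_matrix)
  have "{v. M *v v = 0} = (range (adjoint ((*v) M)))\<^sup>\<bottom>"
    using ker_orthogonal_comp_adjoint[of "(*v) M"] by (auto simp: vimage_def)
  then have "orthogonal_comp {v. M *v v = 0} = (range ((*v) (transpose M)))\<^sup>\<bottom>\<^sup>\<bottom>"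
    by (simp only: adj)
  also have "\<dots> = range ((*v) (transpose M))"
    by (intro orthogonal_comp_self linear_subspace_image) auto
  finally show ?thesis by simp
qed

lemma char_vec_nth: "char_vec S $ i = (if i \<in> S then 1 else 0)"
  by (simp add: char_vec_def indicator_def)

lemma real_card_Int_eq_sum: "real (card (L \<inter> S)) = (\<Sum>i\<in>S. char_vec L $ i)"
  for L S :: "'i::finite set"
  by (simp add: char_vec_nth sum.If_cases Int_commute)

lemma real_card_disjoint:
  fixes L :: "('a::{field,finite}, 'n::finite, 'l::finite) att_n set"
  shows "real (card {\<sigma> \<in> L. att_disjoint \<sigma> \<pi>}) = (disj_matrix *v char_vec L) $ \<pi>"
proof -
  have "(disj_matrix *v char_vec L) $ \<pi> = (\<Sum>\<sigma>\<in>UNIV. if \<sigma> \<in> {\<sigma> \<in> L. att_disjoint \<sigma> \<pi>} then 1 else 0)"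
    unfolding disj_matrix_def matrix_vector_mult_def char_vec_nth vec_lambda_beta
    by (intro sum.cong) (auto simp: att_disjoint_def Int_commute)
  then show ?thesis by (simp add: sum.If_cases)
qed

lemma sum_att_n: "(\<Sum>\<pi>\<in>UNIV. f \<pi>) = (\<Sum>A\<in>UNIV. f (graph_n A))"
  by (rule sum.reindex_bij_betw[OF bij_graph_n, symmetric])

text \<open>This is the entry of \<open>inc_matrix *v v\<close> at the point spanned by
  \<open>(u, w)\<close>, which lies in the graph of \<open>A\<close> iff
  \<open>uA = w\<close>.\<close>

lemma inc_matrix_kernel:
  fixes v :: "real ^ ('a::{field,finite}, 'n::finite, 'l::finite) att_n"
  assumes "inc_matrix *v v = 0" "u \<noteq> 0"
  shows "(\<Sum>A | u v* A = w. v $ graph_n A) = 0"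
proof -
  let ?p = "Abs_att_1 (vec.span {vpair u w}) :: ('a, 'n, 'l) att_1"
  have Rep: "Rep_att_1 ?p = vec.span {vpair u w}"
    using span_vpair_mem_att_subspaces[OF assms(2)] by (rule Abs_att_1_inverse)
  have "0 = (inc_matrix *v v) $ ?p" using assms(1) by simp
  also have "\<dots> = (\<Sum>\<pi>\<in>UNIV. if vec.span {vpair u w} \<subseteq> Rep_att_n \<pi> then v $ \<pi> else 0)"
    unfolding inc_matrix_def matrix_vector_mult_def vec_lambda_beta Rep by (intro sum.cong) auto
  also have "\<dots> = (\<Sum>A\<in>UNIV. if u v* A = w then v $ graph_n A else 0)"
    unfolding sum_att_n by (intro sum.cong) (auto simp: span_vpair_subset_iff)
  also have "\<dots> = (\<Sum>A | u v* A = w. v $ graph_n A)"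
    by (intro sum.mono_neutral_cong_right) auto
  finally show ?thesis by simp
qed

lemma disj_eigenspace_subset_orthogonal_comp:
  fixes v :: "real ^ ('a::{field,finite}, 'n::finite, 'l::finite) att_n"
  assumes "CARD('n) \<le> CARD('l)" "j \<in> {0, 1}" "v \<in> disj_eigenspace j"
  shows "v \<in> orthogonal_comp {y. inc_matrix *v y = 0}"
  unfolding orthogonal_comp_def orthogonal_def
proof clarify
  fix y :: "real ^ ('a, 'n, 'l) att_n" assume y: "inc_matrix *v y = 0"
  have "(\<Sum>A\<in>UNIV. v $ graph_n A * y $ graph_n A) = 0"
    using assms inc_matrix_kernel[OF y]
    by (intro disj_sum_eigenfunction_orthogonal[of j]) (auto simp: disj_eigenspace_iff)
  then show "y \<bullet> v = 0" by (simp add: inner_vec_def sum_att_n mult.commute)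
qed

lemma att_spread_ex1:
  assumes "att_spread S" "vec.subspace P" "vec.dim P = 1"
  shows "\<exists>!U. U \<in> insert att_E (Rep_att_n ` S) \<and> P \<subseteq> U"
proof -
  from assms(1) have "\<forall>P. vec.subspace P \<and> vec.dim P = 1 \<longrightarrow>
      (\<exists>!U. U \<in> insert att_E (Rep_att_n ` S) \<and> P \<subseteq> U)"
    unfolding att_spread_def by (rule conjunct2)
  from mp[OF spec[OF this] conjI[OF assms(2,3)]] show ?thesis .
qed

lemma att_1_subspace: "vec.subspace (Rep_att_1 p)" "vec.dim (Rep_att_1 p) = 1" "Rep_att_1 p \<inter> att_E = {0}"
  using Rep_att_1[of p] by (auto simp: att_subspaces_def)

lemma att_spread_unique:
  assumes "att_spread S" "\<pi> \<in> S" "\<pi>' \<in> S" "Rep_att_1 p \<subseteq> Rep_att_n \<pi>" "Rep_att_1 p \<subseteq> Rep_att_n \<pi>'"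
  shows "\<pi> = \<pi>'"
proof -
  note ex1 = att_spread_ex1[OF assms(1) att_1_subspace(1,2)[of p]]
  have "Rep_att_n \<pi> \<in> insert att_E (Rep_att_n ` S) \<and> Rep_att_1 p \<subseteq> Rep_att_n \<pi>"
    "Rep_att_n \<pi>' \<in> insert att_E (Rep_att_n ` S) \<and> Rep_att_1 p \<subseteq> Rep_att_n \<pi>'"
    using assms(2-) by simp_all
  from this[THEN the1_equality[OF ex1]] show ?thesis
    by (simp add: Rep_att_n_inject)
qed

lemma att_spread_exists:
  assumes "att_spread S"
  obtains \<pi> where "\<pi> \<in> S" "Rep_att_1 p \<subseteq> Rep_att_n \<pi>"
proof -
  note p = att_1_subspace[of p]
  have "\<exists>U. U \<in> insert att_E (Rep_att_n ` S) \<and> Rep_att_1 p \<subseteq> U"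
    using att_spread_ex1[OF assms p(1,2)] by (rule ex1_implies_ex)
  then obtain U where U: "U \<in> insert att_E (Rep_att_n ` S)" "Rep_att_1 p \<subseteq> U"
    by (elim exE conjE)
  have "U \<noteq> att_E"
  proof
    assume "U = att_E"
    with U(2) p(3) have "Rep_att_1 p = {0}" by (simp add: Int_absorb2)
    with p(2) show False by (simp add: vec.dim_eq_0)
  qed
  with U obtain \<pi> where "\<pi> \<in> S" "U = Rep_att_n \<pi>" by auto
  with U(2) show ?thesis by (intro that) simp_all
qed

text \<open>Double counting gives the size of \<open>L \<inter> R\<close> as the sum of
  \<open>y\<close> over the covered points, since each of them lies in exactly one member of
  \<open>R\<close>; this depends on the covered set alone.\<close>

lemma card_Int_conjugate_switching:
  assumes "char_vec L \<in> range (\<lambda>y. transpose inc_matrix *v y)" "conjugate_switching R R'"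
  shows "card (L \<inter> R) = card (L \<inter> R')"
proof -
  from assms(1) obtain y where y: "char_vec L = transpose inc_matrix *v y" by blast
  have "real (card (L \<inter> R)) = (\<Sum>p\<in>covered R. y $ p)" if partial: "att_partial_spread R" for R
  proof -
    obtain S where S: "att_spread S" "R \<subseteq> S" using partial by (auto simp: att_partial_spread_def)
    have inner: "(\<Sum>\<pi>\<in>R. inc_matrix $ p $ \<pi>) = (if p \<in> covered R then 1 else (0::real))" for p
    proof (cases "p \<in> covered R")
      case True
      then obtain \<pi> where \<pi>: "\<pi> \<in> R" "Rep_att_1 p \<subseteq> Rep_att_n \<pi>" by (auto simp: covered_def)
      have "(\<Sum>\<rho>\<in>R. inc_matrix $ p $ \<rho>) = (\<Sum>\<rho>\<in>R. if \<rho> = \<pi> then 1 else (0::real))"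
        using att_spread_unique[OF S(1)] S(2) \<pi> by (intro sum.cong) (auto simp: inc_matrix_def)
      then show ?thesis using True \<pi> by simp
    next
      case False
      then show ?thesis by (auto simp: covered_def inc_matrix_def intro!: sum.neutral)
    qed
    have "real (card (L \<inter> R)) = (\<Sum>\<pi>\<in>R. \<Sum>p\<in>UNIV. inc_matrix $ p $ \<pi> * y $ p)"
      unfolding real_card_Int_eq_sum y by (simp add: vector_matrix_mult_def mult.commute)
    also have "\<dots> = (\<Sum>p\<in>UNIV. (\<Sum>\<pi>\<in>R. inc_matrix $ p $ \<pi>) * y $ p)"
      by (subst sum.swap) (simp add: sum_distrib_right)
    also have "\<dots> = (\<Sum>p\<in>covered R. y $ p)"
      unfolding inner by (intro sum.mono_neutral_cong_right) auto
    finally show ?thesis .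
  qed
  then have "real (card (L \<inter> R)) = real (card (L \<inter> R'))"
    using assms(2) by (simp add: conjugate_switching_def)
  then show ?thesis by simp
qed

text \<open>Both spreads cover every point once, so a point covered by \<open>S - S'\<close> lies in
  a member of \<open>S'\<close> that cannot belong to \<open>S\<close>.\<close>

lemma conjugate_switching_spread_Diff:
  assumes "att_spread S" "att_spread S'"
  shows "conjugate_switching (S - S') (S' - S)"
proof -
  have "covered (S - S') \<subseteq> covered (S' - S)" if S: "att_spread S" "att_spread S'" for S S' :: "('a, 'b, 'c) att_n set"
  proof
    fix p assume "p \<in> covered (S - S')"
    then obtain \<pi> where \<pi>: "\<pi> \<in> S - S'" "Rep_att_1 p \<subseteq> Rep_att_n \<pi>" by (auto simp: covered_def)
    obtain \<pi>' where \<pi>': "\<pi>' \<in> S'" "Rep_att_1 p \<subseteq> Rep_att_n \<pi>'" using att_spread_exists[OF S(2)] .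
    have "\<pi>' \<notin> S" using att_spread_unique[OF S(1), of \<pi> \<pi>' p] \<pi> \<pi>' by auto
    with \<pi>' show "p \<in> covered (S' - S)" by (auto simp: covered_def)
  qed
  from this[OF assms] this[OF assms(2,1)] show ?thesis
    using assms unfolding conjugate_switching_def att_partial_spread_def by blast
qed

lemma card_Int_spreads_eq:
  assumes "\<forall>R R'. conjugate_switching R R' \<longrightarrow> card (L \<inter> R) = card (L \<inter> R')"
    and "att_spread S" "att_spread S'"
  shows "card (L \<inter> S) = card (L \<inter> S')"
proof -
  have *: "card (L \<inter> (S - S')) = card (L \<inter> (S' - S))"
    using assms(1) conjugate_switching_spread_Diff[OF assms(2,3)] by blast
  have split: "card (L \<inter> S) = card (L \<inter> (S - S')) + card (L \<inter> S \<inter> S')" for S S'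
    by (subst card_Un_disjoint[symmetric]) (auto intro!: arg_cong[of _ _ card])
  show ?thesis using split[of S S'] split[of S' S] * by (simp add: Int_commute Int_left_commute)
qed

section \<open>Spreads from the field multiplication\<close>

locale division_mult =
  fixes mul :: "'a::{field,finite} ^ 'l::finite \<Rightarrow> 'a ^ 'l \<Rightarrow> 'a ^ 'l"
  assumes mul_add_left: "mul (x + y) z = mul x z + mul y z"
    and mul_add_right: "mul x (y + z) = mul x y + mul x z"
    and mul_scale: "mul x (c *s y) = c *s mul x y"
    and mul_eq_0: "mul x y = 0 \<Longrightarrow> x = 0 \<or> y = 0"
begin

lemma mul_0 [simp]: "mul 0 y = 0" "mul x 0 = 0"
  using mul_add_left[of 0 0 y] mul_add_right[of x 0 0] by simp_all

lemma mul_sum: "mul x (\<Sum>i\<in>I. f i) = (\<Sum>i\<in>I. mul x (f i))"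
  by (induction I rule: infinite_finite_induct) (simp_all add: mul_add_right)

lemma inj_mul_left: "z \<noteq> 0 \<Longrightarrow> inj (\<lambda>k. mul k z)"
proof (rule injI)
  fix k k' assume z: "z \<noteq> 0" and eq: "mul k z = mul k' z"
  have "mul (k - k') z + mul k' z = mul k z" by (simp flip: mul_add_left)
  with eq have "mul (k - k') z = 0" by simp
  with mul_eq_0 z show "k = k'" by fastforce
qed

definition row_mul :: "'a ^ 'l \<Rightarrow> 'a ^ 'l ^ 'n::finite \<Rightarrow> 'a ^ 'l ^ 'n" where
  "row_mul k g = (\<chi> i. mul k (g $ i))"

text \<open>Linearity of \<open>mul k\<close> in its second argument reduces questions about
  \<open>row_mul\<close> to single vectors.\<close>

lemma vec_mult_row_mul: "u v* row_mul k g = mul k (u v* g)"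
  by (simp add: vec_mult_eq_sum row_mul_def mul_sum mul_scale)

lemma row_mul_0 [simp]: "row_mul 0 g = 0"
  by (simp add: row_mul_def vec_eq_iff)

lemma row_mul_mem_injective_matrices:
  "k \<noteq> 0 \<Longrightarrow> g \<in> injective_matrices \<Longrightarrow> row_mul k g \<in> injective_matrices"
  unfolding injective_matrices_iff vec_mult_row_mul using mul_eq_0 by blast

text \<open>Allows \<open>row_mul k g\<close> to be replaced by \<open>g\<close> in sums over the
  injective matrices.\<close>

lemma bij_betw_row_mul:
  fixes k :: "'a ^ 'l"
  assumes "k \<noteq> 0"
  shows "bij_betw (row_mul k) injective_matrices (injective_matrices :: ('a ^ 'l ^ 'n::finite) set)"
proof -
  have inj: "y = z" if "mul k y = mul k z" for y z
  proof -
    have "mul k (y - z) + mul k z = mul k y" by (simp flip: mul_add_right)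
    with that have "mul k (y - z) = 0" by simp
    with mul_eq_0 assms show ?thesis by fastforce
  qed
  have "inj_on (row_mul k) (injective_matrices :: ('a ^ 'l ^ 'n) set)"
  proof (rule inj_onI)
    fix x y :: "'a ^ 'l ^ 'n" assume eq: "row_mul k x = row_mul k y"
    have "x $ i = y $ i" for i
      using arg_cong[OF eq, of "\<lambda>M. M $ i"] by (simp add: row_mul_def inj)
    then show "x = y" by (simp add: vec_eq_iff)
  qed
  moreover from this have "row_mul k ` injective_matrices = (injective_matrices :: ('a ^ 'l ^ 'n) set)"
    by (intro endo_inj_surj) (use row_mul_mem_injective_matrices[OF assms] in auto)
  ultimately show ?thesis by (simp add: bij_betw_def)
qed

text \<open>
  When \<open>g\<close> is injective, so are all differences \<open>row_mul (k - k') g\<close> with \<open>k \<noteq> k'\<close>.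
\<close>

definition std_spread :: "'a ^ 'l ^ 'n::finite \<Rightarrow> 'a ^ 'l ^ 'n \<Rightarrow> ('a, 'n, 'l) att_n set" where
  "std_spread A g = range (\<lambda>k. graph_n (A - row_mul k g))"

lemma inj_std_spread:
  fixes A :: "'a ^ 'l ^ 'n::finite"
  assumes "g \<in> injective_matrices"
  shows "inj (\<lambda>k. graph_n (A - row_mul k g))"
proof (rule injI)
  fix k k' assume "graph_n (A - row_mul k g) = graph_n (A - row_mul k' g)"
  then have "A - row_mul k g = A - row_mul k' g" by (rule injD[OF bij_is_inj[OF bij_graph_n]])
  then have eq: "row_mul k g = row_mul k' g" by simp
  \<comment> \<open>A unit vector picks out a row of \<open>g\<close>, which is nonzero and can be
    cancelled from the products with \<open>k\<close> and \<open>k'\<close>.\<close>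
  let ?z = "axis undefined 1 v* g"
  have "?z \<noteq> 0"
    using assms axis_eq_0_iff[of undefined "1 :: 'a"] by (auto simp: injective_matrices_iff)
  moreover have "mul k ?z = mul k' ?z" by (simp add: eq flip: vec_mult_row_mul)
  ultimately show "k = k'" by (rule injD[OF inj_mul_left])
qed

text \<open>The span of \<open>(u, w)\<close> lies in the graph for \<open>k\<close> iff
  \<open>mul k (u v* g) = u v* A - w\<close>. If \<open>u \<noteq> 0\<close>, multiplication by the
  nonzero \<open>u v* g\<close> is bijective and exactly one \<open>k\<close> works; if
  \<open>u = 0\<close>, the line lies in \<open>att_E\<close> only.\<close>

lemma att_spread_std_spread:
  fixes A :: "'a ^ 'l ^ 'n::finite"
  assumes g: "g \<in> injective_matrices"
  shows "att_spread (std_spread A g)"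
  unfolding att_spread_def
proof (intro conjI allI impI)
  show "card (std_spread A g) = CARD('a) ^ CARD('l)"
    unfolding std_spread_def using card_image[OF inj_std_spread[OF g, of A]] by simp
  fix P :: "('a ^ ('n + 'l)) set" assume "vec.subspace P \<and> vec.dim P = 1"
  then obtain v where v: "v \<noteq> 0" "P = vec.span {v}" using dim_1_imp_span by blast
  obtain u w where uw: "v = vpair u w" by (rule vpair_exhaust)
  have E: "P \<subseteq> att_E \<longleftrightarrow> u = 0"
  proof -
    have "P \<subseteq> att_E \<longleftrightarrow> v \<in> att_E"
      using vec.span_minimal[of "{v}" att_E] vec.span_base[of v "{v}"] v(2)
      by (auto simp: att_E_def)
    then show ?thesis by (simp add: uw att_E_iff)
  qed
  have G: "P \<subseteq> mgraph (A - row_mul k g) \<longleftrightarrow> mul k (u v* g) = u v* A - w" for k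
    unfolding v(2) uw span_vpair_subset_iff
    by (auto simp: vector_matrix_mult_diff_rdistrib vec_mult_row_mul algebra_simps)
  show "\<exists>!U. U \<in> insert att_E (Rep_att_n ` std_spread A g) \<and> P \<subseteq> U"
  proof (cases "u = 0")
    case True
    then have "w \<noteq> 0" using v uw by (auto simp: vpair_0)
    then have "\<not> P \<subseteq> mgraph (A - row_mul k g)" for k
      unfolding G using True by simp
    then show ?thesis using E True by (auto simp: std_spread_def)
  next
    case False
    then have "u v* g \<noteq> 0" using g by (auto simp: injective_matrices_iff)
    then have inj: "inj (\<lambda>k. mul k (u v* g))" by (rule inj_mul_left)
    then have "surj (\<lambda>k. mul k (u v* g))" by (simp add: finite_UNIV_inj_surj)
    then obtain k where k: "mul k (u v* g) = u v* A - w" by (metis surjD)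
    show ?thesis
    proof (rule ex1I[of _ "mgraph (A - row_mul k g)"])
      show "mgraph (A - row_mul k g) \<in> insert att_E (Rep_att_n ` std_spread A g) \<and> P \<subseteq> mgraph (A - row_mul k g)"
        using k by (auto simp: G std_spread_def image_image)
      fix U assume "U \<in> insert att_E (Rep_att_n ` std_spread A g) \<and> P \<subseteq> U"
      then obtain k' where k': "U = mgraph (A - row_mul k' g)" "P \<subseteq> mgraph (A - row_mul k' g)"
        using E False by (auto simp: std_spread_def image_image)
      then have "mul k' (u v* g) = mul k (u v* g)" using k by (simp add: G)
      then have "k' = k" using inj by (simp add: inj_def)
      then show "U = mgraph (A - row_mul k g)" using k' by simp
    qed
  qed
qed

lemma real_card_Int_std_spread:
  assumes "g \<in> injective_matrices"
  shows "real (card (L \<inter> std_spread A g)) = (\<Sum>k\<in>UNIV. char_vec L $ graph_n (A - row_mul k g))"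
  unfolding real_card_Int_eq_sum std_spread_def
  by (simp add: sum.reindex[OF inj_std_spread[OF assms]])

text \<open>The index \<open>k = 0\<close> gives the graph of \<open>A\<close> for every
  \<open>g\<close>. For each of the \<open>q ^ l - 1\<close> other \<open>k\<close>,
  \<open>row_mul k\<close> permutes the injective matrices, so the sum over \<open>g\<close> is
  \<open>disj_sum\<close>.\<close>

lemma sum_card_Int_std_spread:
  fixes A :: "'a ^ 'l ^ 'n::finite"
  shows "(\<Sum>g\<in>injective_matrices. real (card (L \<inter> std_spread A g))) =
    real (card (injective_matrices :: ('a ^ 'l ^ 'n) set)) * char_vec L $ graph_n A
    + (real CARD('a) ^ CARD('l) - 1) * disj_sum (\<lambda>A. char_vec L $ graph_n A) A"
proof -
  let ?f = "\<lambda>A. char_vec L $ graph_n A"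
  let ?D = "injective_matrices :: ('a ^ 'l ^ 'n) set"
  have "(\<Sum>g\<in>?D. real (card (L \<inter> std_spread A g))) = (\<Sum>g\<in>?D. \<Sum>k\<in>UNIV. ?f (A - row_mul k g))"
    by (intro sum.cong refl real_card_Int_std_spread)
  also have "\<dots> = (\<Sum>k\<in>UNIV. \<Sum>g\<in>?D. ?f (A - row_mul k g))" by (rule sum.swap)
  also have "\<dots> = (\<Sum>g\<in>?D. ?f (A - row_mul 0 g)) + (\<Sum>k\<in>UNIV - {0}. \<Sum>g\<in>?D. ?f (A - row_mul k g))"
    by (rule sum.remove) auto
  also have "(\<Sum>k\<in>UNIV - {0}. \<Sum>g\<in>?D. ?f (A - row_mul k g)) = (\<Sum>k\<in>UNIV - {0::'a ^ 'l}. disj_sum ?f A)"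
  proof (rule sum.cong[OF refl])
    fix k :: "'a ^ 'l" assume "k \<in> UNIV - {0}"
    then have "bij_betw (row_mul k) ?D ?D" by (intro bij_betw_row_mul) simp
    then show "(\<Sum>g\<in>?D. ?f (A - row_mul k g)) = disj_sum ?f A"
      unfolding disj_sum_def by (rule sum.reindex_bij_betw)
  qed
  finally show ?thesis by (simp add: card_Diff_subset of_nat_diff)
qed

text \<open>For fixed \<open>k\<close>, \<open>A - row_mul k g\<close> runs through all matrices as
  \<open>A\<close> does, so each of the \<open>q ^ l\<close> values of \<open>k\<close> counts
  \<open>L\<close> once.\<close>

lemma sum_translates_card_Int_std_spread:
  fixes L :: "('a, 'n::finite, 'l) att_n set" and g :: "'a ^ 'l ^ 'n"
  assumes "g \<in> injective_matrices"
  shows "(\<Sum>A\<in>UNIV. real (card (L \<inter> std_spread A g))) = real CARD('a) ^ CARD('l) * real (card L)"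
proof -
  let ?f = "\<lambda>A. char_vec L $ graph_n A"
  have "(\<Sum>A\<in>UNIV. real (card (L \<inter> std_spread A g))) = (\<Sum>A\<in>UNIV. \<Sum>k\<in>UNIV. ?f (A - row_mul k g))"
    by (intro sum.cong refl real_card_Int_std_spread assms)
  also have "\<dots> = (\<Sum>k\<in>UNIV. \<Sum>A\<in>UNIV. ?f (A - row_mul k g))" by (rule sum.swap)
  also have "\<dots> = (\<Sum>k\<in>(UNIV :: ('a ^ 'l) set). \<Sum>A\<in>UNIV. ?f A)"
  proof (rule sum.cong[OF refl])
    fix k
    show "(\<Sum>A\<in>UNIV. ?f (A - row_mul k g)) = (\<Sum>A\<in>UNIV. ?f A)"
      by (rule sum.reindex_bij_witness[of _ "\<lambda>A. A + row_mul k g" "\<lambda>A. A - row_mul k g"]) auto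
  qed
  also have "(\<Sum>A\<in>UNIV. ?f A) = real (card L)"
    using real_card_Int_eq_sum[of L UNIV] by (simp add: sum_att_n)
  finally show ?thesis by simp
qed

end

section \<open>The equivalences\<close>

text \<open>All row sums of the disjointness matrix equal the number of injective matrices, which is
  \<open>\<lambda>\<^sub>0\<close>.\<close>

lemma all_one_mem_disj_eigenspace_0:
  assumes "CARD('n::finite) \<le> CARD('l::finite)"
  shows "((\<chi> \<pi>. 1) :: real ^ ('a::{field,finite}, 'n, 'l) att_n) \<in> disj_eigenspace 0"
proof -
  have "1 \<le> CARD('n)" by (simp add: Suc_le_eq)
  then show ?thesis
    using card_injective_matrices[OF assms, where 'a='a] assms
    by (simp add: disj_eigenspace_iff disj_sum_def disj_eigenvalue_0_1)
qed

theorem theorem2p10: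
  fixes L :: "('a::{field,finite}, 'n::finite, 'l::finite) att_n set"
    and q n l :: nat and x :: int
  assumes q: "q = CARD('a)" and n: "n = CARD('n)" and l: "l = CARD('l)"
    and "1 \<le> n" and "n \<le> l"
    and "L \<noteq> {}"
    and "int (card L) = x * int q ^ ((n - 1) * l)"
  shows
    "(char_vec L \<in> range (\<lambda>y. transpose inc_matrix *v y)
        \<longleftrightarrow> char_vec L \<in> orthogonal_comp {v. inc_matrix *v v = 0})
   \<and> (char_vec L \<in> range (\<lambda>y. transpose inc_matrix *v y)
        \<longleftrightarrow> (\<forall>\<pi>. real (card {\<sigma> \<in> L. att_disjoint \<sigma> \<pi>})
              = (real_of_int x - char_vec L $ \<pi>) * real q ^ (n choose 2)
                * (\<Prod>s=1..n-1. real q ^ (l - n + s) - 1)))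
   \<and> (char_vec L \<in> range (\<lambda>y. transpose inc_matrix *v y)
        \<longleftrightarrow> char_vec L - (real_of_int x / real q ^ l) *\<^sub>R (\<chi> \<pi>. 1) \<in> disj_eigenspace 1)
   \<and> (char_vec L \<in> range (\<lambda>y. transpose inc_matrix *v y)
        \<longleftrightarrow> char_vec L \<in> {u + w | u w. u \<in> disj_eigenspace 0 \<and> w \<in> disj_eigenspace 1})
   \<and> (char_vec L \<in> range (\<lambda>y. transpose inc_matrix *v y)
        \<longleftrightarrow> (\<forall>S. att_spread S \<longrightarrow> int (card (L \<inter> S)) = x))
   \<and> (char_vec L \<in> range (\<lambda>y. transpose inc_matrix *v y)
        \<longleftrightarrow> (\<forall>R R'. conjugate_switching R R' \<longrightarrow> card (L \<inter> R) = card (L \<inter> R')))"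
    (is "(?i \<longleftrightarrow> ?ii) \<and> (?i \<longleftrightarrow> ?iii) \<and> (?i \<longleftrightarrow> ?iv) \<and> (?i \<longleftrightarrow> ?v) \<and> (?i \<longleftrightarrow> ?vi) \<and> (?i \<longleftrightarrow> ?vii)")
proof -
  let ?\<chi> = "char_vec L" and ?j = "(\<chi> \<pi>. 1) :: real ^ ('a, 'n, 'l) att_n"
  define \<Lambda> where "\<Lambda> = second_eigenvalue q l n"
  \<comment> \<open>The density of \<open>L\<close> among all \<open>q ^ (n * l)\<close> members,
    and the coefficient of the all-one vector in (iv).\<close>
  define c where "c = real_of_int x / real q ^ l"
  have q1: "q > 1" unfolding q by (rule CARD_field_gt_1)
  have nl: "CARD('n) \<le> CARD('l)" using assms by simp
  have \<Lambda>: "\<Lambda> > 0" unfolding \<Lambda>_def using q1 assms by (intro second_eigenvalue_pos)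
  have ql: "real q ^ l > 1" using q1 assms by (intro one_less_power) auto
  have ev: "disj_eigenvalue CARD('a) CARD('n) CARD('l) 0 = (real q ^ l - 1) * \<Lambda>"
    "disj_eigenvalue CARD('a) CARD('n) CARD('l) 1 = - \<Lambda>"
    using disj_eigenvalue_0_1[of n l q] assms by (simp_all add: \<Lambda>_def)
  let ?D = "injective_matrices :: ('a ^ 'l ^ 'n) set"
  have card_D: "real (card ?D) = (real q ^ l - 1) * \<Lambda>"
    unfolding \<Lambda>_def q l n by (rule card_injective_matrices[OF nl])
  obtain mul :: "'a ^ 'l \<Rightarrow> 'a ^ 'l \<Rightarrow> 'a ^ 'l"
    where "\<And>x y z. mul (x + y) z = mul x z + mul y z" "\<And>x y z. mul x (y + z) = mul x y + mul x z"
      "\<And>x c y. mul x (c *s y) = c *s mul x y" "\<And>x y. mul x y = 0 \<Longrightarrow> x = 0 \<or> y = 0"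
    by (rule ex_division_mult) blast
  then interpret division_mult mul by unfold_locales
  have i_ii: "?i \<longleftrightarrow> ?ii" by (simp only: range_transpose_eq_orthogonal_comp)
  have iii: "?iii \<longleftrightarrow> (\<forall>\<pi>. (disj_matrix *v ?\<chi>) $ \<pi> = (real_of_int x - ?\<chi> $ \<pi>) * \<Lambda>)"
    using second_eigenvalue_eq[OF \<open>n \<le> l\<close>, of q]
    by (simp only: real_card_disjoint \<Lambda>_def mult.assoc)
  have j: "?j \<in> disj_eigenspace 0" by (rule all_one_mem_disj_eigenspace_0[OF nl])
  have iii_iv: "?iii \<longleftrightarrow> ?iv"
  proof -
    have "disj_matrix *v (?\<chi> - c *\<^sub>R ?j) = disj_matrix *v ?\<chi> - (c * ((real q ^ l - 1) * \<Lambda>)) *\<^sub>R ?j"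
      using j unfolding disj_eigenspace_def ev
      by (simp add: matrix_vector_mult_diff_distrib matrix_vector_mult_scaleR)
    then have "?iv \<longleftrightarrow> (\<forall>\<pi>. (disj_matrix *v ?\<chi>) $ \<pi> - c * ((real q ^ l - 1) * \<Lambda>) = - \<Lambda> * (?\<chi> $ \<pi> - c))"
      unfolding disj_eigenspace_def mem_Collect_eq ev c_def[symmetric] by (simp add: vec_eq_iff)
    also have "\<dots> \<longleftrightarrow> (\<forall>\<pi>. (disj_matrix *v ?\<chi>) $ \<pi> = (real_of_int x - ?\<chi> $ \<pi>) * \<Lambda>)"
    proof -
      \<comment> \<open>The two terms with \<open>c\<close> combine to
        \<open>c * q ^ l * \<Lambda> = x * \<Lambda>\<close>.\<close>
      have "real_of_int x = c * real q ^ l" using q1 by (simp add: c_def)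
      then show ?thesis by (simp add: algebra_simps)
    qed
    finally show ?thesis using iii by simp
  qed
  have iv_v: "?v" if ?iv
  proof -
    have "c *\<^sub>R ?j \<in> disj_eigenspace 0"
      using j by (simp add: disj_eigenspace_def matrix_vector_mult_scaleR)
    with that show ?thesis unfolding c_def by force
  qed
  have v_ii: "?ii" if ?v
  proof -
    from that obtain u w where "?\<chi> = u + w" and uw: "u \<in> disj_eigenspace 0" "w \<in> disj_eigenspace 1" by blast
    moreover have "u + w \<in> orthogonal_comp {y. inc_matrix *v y = 0}"
      using disj_eigenspace_subset_orthogonal_comp[OF nl _ uw(1)]
        disj_eigenspace_subset_orthogonal_comp[OF nl _ uw(2)]
      by (intro subspace_add[OF subspace_orthogonal_comp]) simp_all
    ultimately show ?thesis by (simp only:)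
  qed
  have i_vii: "?vii" if ?i using card_Int_conjugate_switching[OF that] by blast
  have vii_vi: "?vi" if vii: ?vii
  proof -
    have "real (card ?D) > 0" unfolding card_D using \<Lambda> ql by simp
    then have "?D \<noteq> {}" by (intro notI) simp
    then obtain g where g: "g \<in> ?D" by blast
    have eq: "int (card (L \<inter> S)) = x" if S: "att_spread S" for S
    proof -
      \<comment> \<open>All translates of one standard spread meet \<open>L\<close> in as many
        members as \<open>S\<close> does, so summing over the \<open>q ^ (n * l)\<close> translates
        determines the constant.\<close>
      have "card (L \<inter> std_spread A g) = card (L \<inter> S)" for A
        using card_Int_spreads_eq[OF vii att_spread_std_spread[OF g] S] .
      then have "real CARD('a ^ 'l ^ 'n) * real (card (L \<inter> S)) = real q ^ l * real (card L)"
        using sum_translates_card_Int_std_spread[OF g, of L] by (simp add: q l)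
      also have "real (card L) = real_of_int x * real q ^ ((n - 1) * l)"
        using assms(7) by (metis of_int_mult of_int_of_nat_eq of_int_power)
      also have "real CARD('a ^ 'l ^ 'n) = real q ^ l * real q ^ ((n - 1) * l)"
        using \<open>1 \<le> n\<close> unfolding q n l
        by (simp add: power_mult[symmetric] power_add[symmetric] algebra_simps)
      finally have "real (card (L \<inter> S)) = real_of_int x" using q1 by simp
      then show ?thesis by (metis of_int_eq_iff of_int_of_nat_eq)
    qed
    then show ?thesis by blast
  qed
  have vi_iii: "?iii" if vi: ?vi
  proof -
    have "(disj_matrix *v ?\<chi>) $ graph_n A = (real_of_int x - ?\<chi> $ graph_n A) * \<Lambda>" for A
    proof -
      have "real (card (L \<inter> std_spread A g)) = real_of_int x" if "g \<in> ?D" for g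
        using vi att_spread_std_spread[OF that, of A] by (metis of_int_of_nat_eq)
      then have "(\<Sum>g\<in>?D. real (card (L \<inter> std_spread A g))) = real (card ?D) * real_of_int x" by simp
      \<comment> \<open>Both sides count pairs of \<open>g\<close> and a member of \<open>L\<close>
        in its spread through \<open>A\<close>; inserting
        \<open>card ?D = (q ^ l - 1) * \<Lambda>\<close> leaves a common factor
        \<open>q ^ l - 1\<close>.\<close>
      then have "(real q ^ l - 1) * disj_sum (\<lambda>A. ?\<chi> $ graph_n A) A
          = (real q ^ l - 1) * ((real_of_int x - ?\<chi> $ graph_n A) * \<Lambda>)"
        unfolding sum_card_Int_std_spread card_D by (simp add: q l algebra_simps)
      then show ?thesis using ql by (simp add: disj_matrix_mult)
    qed
    then show ?thesis unfolding iii all_att_n_iff by blast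
  qed
  \<comment> \<open>The cycle is (i) \<Leftrightarrow> (ii), (i) \<Longrightarrow> (vii)
    \<Longrightarrow> (vi) \<Longrightarrow> (iii) \<Leftrightarrow> (iv) \<Longrightarrow> (v)
    \<Longrightarrow> (ii).\<close>
  show ?thesis using i_ii iii_iv iv_v v_ii i_vii vii_vi vi_iii by argo
qed

end
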